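(* Let $f$ be an excursion and let $(f_n)$ be a sequence of excursions such that $f_n\to f$ for the Skorokhod topology on $[-1,1]$. Assume that at least one of the following holds: (a) there is $N\ge 1$ such that all the $f_n$ have at most $N$ jumps; (b) the excursion $f$ is PJG. Then the three convergences $\mathscr{L}_{f_n}\to\mathscr{L}_f$, $\mathscr{T}_{f_n}\to\mathscr{T}_f$ and $\mathscr{V}_{f_n}\to\mathscr{V}_f$ hold for the pointed Gromov–Hausdorff–Prokhorov topology.
   Context: A càdlàg function is right-continuous with left limits. The space $\mathbb{D}([-1,1])$ of càdlàg functions $[-1,1]\to\mathbb{R}$ has the Skorokhod topology induced by $\rho(f_1,f_2)=\inf_{\lambda\in\Lambda}\max(\|\lambda-\mathsf{id}\|_\infty,\|f_1-f_2\circ\lambda\|_\infty)$, where $\Lambda$ is the set of increasing bijections of $[-1,1]$. For a càdlàg $f$ write $f(t-)=\lim_{s\to t-}f(s)$, $\Delta_t(f)=f(t)-f(t-)$, and $x_s^t(f)=\mathbf{1}_{\{s\le t\}}\max\big(\inf_{[s,t]}f-f(s-),0\big)$; we drop $f$ when clear. An excursion is a nonnegative càdlàg function $f:[-1,1]\to[0,\infty)$ such that $f(s)=f(1)=0$ for all $s\in[-1,0)$ and $\Delta_t(f)\ge 0$ for all $t\in[0,1]$. Set $Jf(t)=\sum_{r\in[0,1]}x_r^t(f)$; $f$ is a pure jump growth (PJG) excursion when $Jf=f$. For $s\in[0,1]$, $\delta_s$ is the pseudo-distance on $[0,\Delta_s]$ given by $\delta_s(x,y)=\min(|x-y|,\Delta_s-|x-y|)$.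 Define on $[-1,1]^2$ the pseudo-distances $d^{\mathsf{L}}_f(s,t)=\sum_{r\in[0,1]}\delta_r(x_r^s,x_r^t)$; $d^{\mathsf{T}}_f(s,t)=d^{\mathsf{T}}_f(t,s)=f(s)+f(t)-2\inf_{[s,t]}f-\sum_{r\in[0,1]}|x_r^s-x_r^t|$ for $s\le t$; $d^{\mathsf{V}}_f=d^{\mathsf{T}}_f+2d^{\mathsf{L}}_f$. For a pseudo-distance $d$ on a set $X$, the quotient metric space of $X$ induced by $d$ is $X/\!\sim_d$ with the distance induced by $d$, where $x\sim_d y$ iff $d(x,y)=0$. $\mathscr{L}_f,\mathscr{T}_f,\mathscr{V}_f$ are the quotient metric spaces of $[0,1]$ induced by $d^{\mathsf{L}}_f,d^{\mathsf{T}}_f,d^{\mathsf{V}}_f$ respectively (they are compact). Each is a pointed weighted compact metric space, with distinguished point the projection of $1$ and Borel probability measure the pushforward of Lebesgue measure on $[0,1]$ by the projection. The pointed Gromov–Hausdorff–Prokhorov (GHP) distance between pointed weighted compact metric spaces $(X_1,d_1,a_1,\mu_1)$ and $(X_2,d_2,a_2,\mu_2)$ is $\inf_{\mathcal{R},\nu}\max\big(\tfrac12\mathrm{dis}(\mathcal{R}),1-\nu(\mathcal{R})\big)$, over couplings $\nu$ of $\mu_1,\mu_2$ (Borel probability measures on $X_1\times X_2$ with these marginals) and compact correspondences $\mathcal{R}\subset X_1\times X_2$ (both coordinate projections of $\mathcal R$ are onto) with $(a_1,a_2)\in\mathcal{R}$, where $\mathrm{dis}(\mathcal{R})=\sup\{|d_1(x_1,y_1)-d_2(x_2,y_2)|:(x_1,x_2),(y_1,y_2)\in\mathcal{R}\}$.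 *)

theory Defs
  imports "HOL-Probability.Probability"
begin

text \<open>
  Functions on \<open>[-1,1]\<close> are represented by total functions on the reals; every definition below
  depends only on their values on \<open>[-1,1]\<close>.
\<close>

definition cadlag :: "(real \<Rightarrow> real) \<Rightarrow> bool" where
  "cadlag f \<longleftrightarrow>
     (\<forall>t\<in>{-1..<1}. (f \<longlongrightarrow> f t) (at_right t)) \<and>
     (\<forall>t\<in>{-1<..1}. \<exists>l. (f \<longlongrightarrow> l) (at_left t))"

definition time_changes :: "(real \<Rightarrow> real) set" where
  "time_changes = {\<phi>. strict_mono_on {-1..1} \<phi> \<and> bij_betw \<phi> {-1..1} {-1..1}}"

definition skorokhod_dist :: "(real \<Rightarrow> real) \<Rightarrow> (real \<Rightarrow> real) \<Rightarrow> real" where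
  "skorokhod_dist f g =
     (INF \<phi>\<in>time_changes.
        max (SUP t\<in>{-1..1}. \<bar>\<phi> t - t\<bar>) (SUP t\<in>{-1..1}. \<bar>f t - g (\<phi> t)\<bar>))"

definition left_lim :: "(real \<Rightarrow> real) \<Rightarrow> real \<Rightarrow> real" where
  "left_lim f t = Lim (at_left t) f"

definition jump :: "(real \<Rightarrow> real) \<Rightarrow> real \<Rightarrow> real" where
  "jump f t = f t - left_lim f t"

definition jump_times :: "(real \<Rightarrow> real) \<Rightarrow> real set" where
  "jump_times f = {t\<in>{-1<..1}. jump f t \<noteq> 0}"

definition excursion :: "(real \<Rightarrow> real) \<Rightarrow> bool" where
  "excursion f \<longleftrightarrow>
     cadlag f \<and> (\<forall>t\<in>{-1..1}. 0 \<le> f t) \<and>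
     (\<forall>s\<in>{-1..<0}. f s = 0) \<and> f 1 = 0 \<and> (\<forall>t\<in>{0..1}. 0 \<le> jump f t)"

text \<open>\<open>xproc f s t\<close> is \<open>x\<^sub>s\<^sup>t(f)\<close>.\<close>

definition xproc :: "(real \<Rightarrow> real) \<Rightarrow> real \<Rightarrow> real \<Rightarrow> real" where
  "xproc f s t = (if s \<le> t then max ((INF u\<in>{s..t}. f u) - left_lim f s) 0 else 0)"

text \<open>
  The sums over \<open>r \<in> [0,1]\<close> here and below are unconditional sums; for an excursion \<open>f\<close> only the
  countably many jump times \<open>r\<close> contribute, and \<open>xproc f r t\<close> sums to at most \<open>f t\<close>.
\<close>

definition pure_jump_part :: "(real \<Rightarrow> real) \<Rightarrow> real \<Rightarrow> real" where
  "pure_jump_part f t = (\<Sum>\<^sub>\<infinity>r\<in>{0..1}. xproc f r t)"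

definition PJG :: "(real \<Rightarrow> real) \<Rightarrow> bool" where
  "PJG f \<longleftrightarrow> excursion f \<and> (\<forall>t\<in>{-1..1}. pure_jump_part f t = f t)"

definition loop_dist :: "(real \<Rightarrow> real) \<Rightarrow> real \<Rightarrow> real \<Rightarrow> real \<Rightarrow> real" where
  "loop_dist f s x y = min \<bar>x - y\<bar> (jump f s - \<bar>x - y\<bar>)"

definition dL :: "(real \<Rightarrow> real) \<Rightarrow> real \<Rightarrow> real \<Rightarrow> real" where
  "dL f s t = (\<Sum>\<^sub>\<infinity>r\<in>{0..1}. loop_dist f r (xproc f r s) (xproc f r t))"

definition dT :: "(real \<Rightarrow> real) \<Rightarrow> real \<Rightarrow> real \<Rightarrow> real" where
  "dT f s t = f s + f t - 2 * (INF u\<in>{min s t..max s t}. f u)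
     - (\<Sum>\<^sub>\<infinity>r\<in>{0..1}. \<bar>xproc f r s - xproc f r t\<bar>)"

definition dV :: "(real \<Rightarrow> real) \<Rightarrow> real \<Rightarrow> real \<Rightarrow> real" where
  "dV f s t = dT f s t + 2 * dL f s t"

definition pseudo_dist_on :: "'a set \<Rightarrow> ('a \<Rightarrow> 'a \<Rightarrow> real) \<Rightarrow> bool" where
  "pseudo_dist_on X d \<longleftrightarrow>
     (\<forall>x\<in>X. d x x = 0) \<and> (\<forall>x\<in>X. \<forall>y\<in>X. 0 \<le> d x y \<and> d x y = d y x) \<and>
     (\<forall>x\<in>X. \<forall>y\<in>X. \<forall>z\<in>X. d x z \<le> d x y + d y z)"

definition zero_rel :: "'a set \<Rightarrow> ('a \<Rightarrow> 'a \<Rightarrow> real) \<Rightarrow> ('a \<times> 'a) set" where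
  "zero_rel X d = {(x, y). x \<in> X \<and> y \<in> X \<and> d x y = 0}"

definition quot_proj :: "'a set \<Rightarrow> ('a \<Rightarrow> 'a \<Rightarrow> real) \<Rightarrow> 'a \<Rightarrow> 'a set" where
  "quot_proj X d x = zero_rel X d `` {x}"

text \<open>
  The distance is evaluated on arbitrary representatives. The value \<open>0\<close> outside the quotient is
  there because \<open>Metric_space\<close> requires nonnegativity and symmetry off the carrier as well.
\<close>

definition quot_dist :: "'a set \<Rightarrow> ('a \<Rightarrow> 'a \<Rightarrow> real) \<Rightarrow> 'a set \<Rightarrow> 'a set \<Rightarrow> real" where
  "quot_dist X d A B =
     (if A \<in> X // zero_rel X d \<and> B \<in> X // zero_rel X d
      then d (SOME a. a \<in> A) (SOME b. b \<in> B) else 0)"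

lemma equiv_zero_rel:
  assumes "pseudo_dist_on X d"
  shows "equiv X (zero_rel X d)"
proof (rule equivI)
  show "zero_rel X d \<subseteq> X \<times> X" by (auto simp: zero_rel_def)
  show "refl_on X (zero_rel X d)"
    using assms by (auto simp: refl_on_def zero_rel_def pseudo_dist_on_def)
  show "sym (zero_rel X d)"
    using assms by (auto simp: sym_def zero_rel_def pseudo_dist_on_def)
  show "trans (zero_rel X d)"
  proof (rule transI)
    fix x y z assume "(x, y) \<in> zero_rel X d" "(y, z) \<in> zero_rel X d"
    then have *: "x \<in> X" "y \<in> X" "z \<in> X" "d x y = 0" "d y z = 0"
      by (auto simp: zero_rel_def)
    then have "d x z \<le> d x y + d y z" "0 \<le> d x z"
      using assms unfolding pseudo_dist_on_def by blast+
    then show "(x, z) \<in> zero_rel X d" using * by (auto simp: zero_rel_def)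
  qed
qed

lemma quot_dist_proj:
  assumes pd: "pseudo_dist_on X d" and x: "x \<in> X" and y: "y \<in> X"
  shows "quot_dist X d (quot_proj X d x) (quot_proj X d y) = d x y"
proof -
  have rep: "\<exists>a\<in>X. (SOME a. a \<in> quot_proj X d z) = a \<and> d z a = 0" if "z \<in> X" for z
  proof -
    have "z \<in> quot_proj X d z"
      using that pd by (auto simp: quot_proj_def zero_rel_def pseudo_dist_on_def)
    then have "(SOME a. a \<in> quot_proj X d z) \<in> quot_proj X d z" by (rule someI)
    then show ?thesis by (auto simp: quot_proj_def zero_rel_def)
  qed
  obtain a where a: "a \<in> X" "(SOME a. a \<in> quot_proj X d x) = a" "d x a = 0"
    using rep[OF x] by blast
  obtain b where b: "b \<in> X" "(SOME a. a \<in> quot_proj X d y) = b" "d y b = 0"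
    using rep[OF y] by blast
  have tri: "d u w \<le> d u v + d v w" and sym: "d u v = d v u"
    if "u \<in> X" "v \<in> X" "w \<in> X" for u v w
    using pd that unfolding pseudo_dist_on_def by blast+
  have "d a b \<le> d x y"
    using tri[of a x b] tri[of x y b] sym[of a x x] a b x y by simp
  moreover have "d x y \<le> d a b"
    using tri[of x a y] tri[of a b y] sym[of b y y] a b x y by simp
  ultimately have "d a b = d x y" by simp
  moreover have "quot_proj X d x \<in> X // zero_rel X d" "quot_proj X d y \<in> X // zero_rel X d"
    using x y by (auto simp: quot_proj_def intro: quotientI)
  ultimately show ?thesis by (simp add: quot_dist_def a b)
qed

lemma Metric_space_quot:
  assumes pd: "pseudo_dist_on X d"
  shows "Metric_space (X // zero_rel X d) (quot_dist X d)"
proof -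
  have ex: "\<exists>x\<in>X. A = quot_proj X d x" if "A \<in> X // zero_rel X d" for A
    using that by (auto simp: quot_proj_def elim: quotientE)
  have pdD: "0 \<le> d x y" "d x y = d y x" "d x z \<le> d x y + d y z"
    if "x \<in> X" "y \<in> X" "z \<in> X" for x y z
    using pd that unfolding pseudo_dist_on_def by blast+
  show ?thesis
  proof
    fix A B
    show "0 \<le> quot_dist X d A B"
    proof (cases "A \<in> X // zero_rel X d \<and> B \<in> X // zero_rel X d")
      case True
      then obtain x y where "x \<in> X" "y \<in> X" "A = quot_proj X d x" "B = quot_proj X d y"
        using ex by meson
      then show ?thesis using pdD by (simp add: quot_dist_proj[OF pd])
    qed (auto simp: quot_dist_def)
    show "quot_dist X d A B = quot_dist X d B A"
    proof (cases "A \<in> X // zero_rel X d \<and> B \<in> X // zero_rel X d")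
      case True
      then obtain x y where "x \<in> X" "y \<in> X" "A = quot_proj X d x" "B = quot_proj X d y"
        using ex by meson
      then show ?thesis using pdD by (simp add: quot_dist_proj[OF pd])
    qed (auto simp: quot_dist_def)
  next
    fix A B assume "A \<in> X // zero_rel X d" "B \<in> X // zero_rel X d"
    then obtain x y where xy: "x \<in> X" "y \<in> X" "A = quot_proj X d x" "B = quot_proj X d y"
      using ex by meson
    have "quot_proj X d x = quot_proj X d y \<longleftrightarrow> (x, y) \<in> zero_rel X d"
      unfolding quot_proj_def using eq_equiv_class_iff[OF equiv_zero_rel[OF pd]] xy by blast
    then show "quot_dist X d A B = 0 \<longleftrightarrow> A = B"
      using xy by (simp add: quot_dist_proj[OF pd] zero_rel_def)
  next
    fix A B C
    assume "A \<in> X // zero_rel X d" "B \<in> X // zero_rel X d" "C \<in> X // zero_rel X d"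
    then obtain x y z where "x \<in> X" "y \<in> X" "z \<in> X"
      "A = quot_proj X d x" "B = quot_proj X d y" "C = quot_proj X d z"
      using ex by meson
    then show "quot_dist X d A C \<le> quot_dist X d A B + quot_dist X d B C"
      using pdD by (simp add: quot_dist_proj[OF pd])
  qed
qed

record 'a pw_space =
  pw_carrier :: "'a set"
  pw_dist :: "'a \<Rightarrow> 'a \<Rightarrow> real"
  pw_point :: 'a
  pw_measure :: "'a measure"

definition pw_topology :: "'a pw_space \<Rightarrow> 'a topology" where
  "pw_topology X = Metric_space.mtopology (pw_carrier X) (pw_dist X)"

definition borel_of :: "'a topology \<Rightarrow> 'a measure" where
  "borel_of T = sigma (topspace T) {U. openin T U}"

definition coded_space :: "(real \<Rightarrow> real \<Rightarrow> real) \<Rightarrow> real set pw_space" where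
  "coded_space d =
     (let I = {0..1}; Q = I // zero_rel I d; \<rho> = quot_dist I d in
      \<lparr> pw_carrier = Q, pw_dist = \<rho>, pw_point = quot_proj I d 1,
        pw_measure =
          distr (lebesgue_on I) (borel_of (Metric_space.mtopology Q \<rho>)) (quot_proj I d) \<rparr>)"

definition looptree :: "(real \<Rightarrow> real) \<Rightarrow> real set pw_space" where
  "looptree f = coded_space (dL f)"

definition tree_space :: "(real \<Rightarrow> real) \<Rightarrow> real set pw_space" where
  "tree_space f = coded_space (dT f)"

definition vernation_tree :: "(real \<Rightarrow> real) \<Rightarrow> real set pw_space" where
  "vernation_tree f = coded_space (dV f)"

definition couplings :: "'a pw_space \<Rightarrow> 'b pw_space \<Rightarrow> ('a \<times> 'b) measure set" where
  "couplings X Y =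
     {\<nu>. prob_space \<nu> \<and>
         space \<nu> = pw_carrier X \<times> pw_carrier Y \<and>
         sets \<nu> = sets (borel_of (prod_topology (pw_topology X) (pw_topology Y))) \<and>
         distr \<nu> (borel_of (pw_topology X)) fst = pw_measure X \<and>
         distr \<nu> (borel_of (pw_topology Y)) snd = pw_measure Y}"

definition compact_correspondences :: "'a pw_space \<Rightarrow> 'b pw_space \<Rightarrow> ('a \<times> 'b) set set" where
  "compact_correspondences X Y =
     {R. compactin (prod_topology (pw_topology X) (pw_topology Y)) R \<and>
         fst ` R = pw_carrier X \<and> snd ` R = pw_carrier Y}"

text \<open>
  Extended reals are used so that suprema of unbounded sets and infima of empty sets are infinite
  rather than arbitrary. For compact spaces, distortion and distance are finite.
\<close>

definition distortion :: "'a pw_space \<Rightarrow> 'b pw_space \<Rightarrow> ('a \<times> 'b) set \<Rightarrow> ereal" where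
  "distortion X Y R =
     (SUP (p, q)\<in>R \<times> R. ereal \<bar>pw_dist X (fst p) (fst q) - pw_dist Y (snd p) (snd q)\<bar>)"

definition GHP_dist :: "'a pw_space \<Rightarrow> 'b pw_space \<Rightarrow> ereal" where
  "GHP_dist X Y =
     (INF (R, \<nu>)\<in>{R \<in> compact_correspondences X Y. (pw_point X, pw_point Y) \<in> R} \<times> couplings X Y.
        max (ereal (1/2) * distortion X Y R) (ereal (1 - measure \<nu> R)))"

end

theory Submission
  imports Defs
begin

text \<open>
  The spaces are quotients of \<open>[0,1]\<close> by pseudo-distances which are continuous, even where \<open>f\<close> jumps:
  at a jump time \<open>t\<close>, the loop distance identifies \<open>x\<^sub>t = 0\<close> with \<open>x\<^sub>t = \<Delta>\<^sub>t\<close>, and in \<open>dT\<close> the jump is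
  compensated by \<open>\<bar>x\<^sub>t\<^sup>s - x\<^sub>t\<^sup>t\<bar> = \<Delta>\<^sub>t\<close>. Hence the projections from \<open>[0,1]\<close> are continuous, the diagonal
  of \<open>[0,1]\<close> induces a compact correspondence carrying a coupling of full mass, and it suffices that
  the pseudo-distances converge uniformly on \<open>[0,1]\<^sup>2\<close>.

  Choose time changes \<open>\<phi>\<close> close to the identity such that \<open>F n\<close> is close to \<open>f \<circ> \<phi>\<close>. All jumps and all \<open>x\<close>
  are then close term by term, so only the tails of the sums over the jumps matter. With at most \<open>N\<close>
  jumps (a bound which \<open>f\<close> inherits) there is no tail. If \<open>f\<close> is PJG, a Dini argument yields a finite
  set of jumps of \<open>f\<close> whose \<open>x\<close> sum up to almost \<open>f\<close>, uniformly in time; as the \<open>x\<close> of \<open>F n\<close> sum up to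
  at most \<open>F n\<close>, its tail is small as well. Uniform continuity of the limit pseudo-distance removes \<open>\<phi>\<close>.
\<close>

section \<open>The Gromov-Hausdorff-Prokhorov distance of coded spaces\<close>

lemma pseudo_dist_onD:
  assumes "pseudo_dist_on X d" "x \<in> X" "y \<in> X"
  shows "d x x = 0" "0 \<le> d x y" "d x y = d y x" "\<And>z. z \<in> X \<Longrightarrow> d x z \<le> d x y + d y z"
  using assms unfolding pseudo_dist_on_def by blast+

lemma pseudo_dist_on_subset:
  assumes "pseudo_dist_on X d" "Y \<subseteq> X"
  shows "pseudo_dist_on Y d"
  using assms unfolding pseudo_dist_on_def by (meson subsetD)

lemma pseudo_dist_on_add:
  assumes "pseudo_dist_on X d" "pseudo_dist_on X d'" "0 \<le> c"
  shows "pseudo_dist_on X (\<lambda>s t. d s t + c * d' s t)"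
proof -
  have "d x z + c * d' x z \<le> d x y + c * d' x y + (d y z + c * d' y z)"
    if "x \<in> X" "y \<in> X" "z \<in> X" for x y z
    using pseudo_dist_onD(4)[OF assms(1) that(1,2,3)]
      mult_left_mono[OF pseudo_dist_onD(4)[OF assms(2) that(1,2,3)] assms(3)]
    by (simp add: algebra_simps)
  then show ?thesis
    using assms pseudo_dist_onD[OF assms(1)] pseudo_dist_onD[OF assms(2)]
    unfolding pseudo_dist_on_def by auto
qed

lemma pseudo_dist_on_diff_le:
  assumes "pseudo_dist_on X d" "x \<in> X" "y \<in> X" "x' \<in> X" "y' \<in> X"
  shows "\<bar>d x y - d x' y'\<bar> \<le> d x x' + d y y'"
  using pseudo_dist_onD(4)[OF assms(1), of x x' y] pseudo_dist_onD(4)[OF assms(1), of x' y' y]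
    pseudo_dist_onD(4)[OF assms(1), of x' x y'] pseudo_dist_onD(4)[OF assms(1), of x y y']
    pseudo_dist_onD(3)[OF assms(1), of x x'] pseudo_dist_onD(3)[OF assms(1), of y y'] assms(2-)
  by simp

text \<open>A pseudo-distance changes by at most \<open>d x x' + d y y'\<close> when both arguments
  move, so joint continuity reduces to smallness of \<open>d s t\<close> for \<open>s\<close> near
  \<open>t\<close>.\<close>

lemma pseudo_dist_on_continuous:
  fixes d :: "'a :: metric_space \<Rightarrow> 'a \<Rightarrow> real"
  assumes pd: "pseudo_dist_on X d"
    and loc: "\<And>t e. t \<in> X \<Longrightarrow> 0 < e \<Longrightarrow> \<exists>\<delta>>0. \<forall>s\<in>X. dist s t < \<delta> \<longrightarrow> d s t < e"
  shows "continuous_on (X \<times> X) (\<lambda>(s, t). d s t)"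
  unfolding continuous_on_iff
proof (intro ballI allI impI, clarsimp)
  fix s t and e :: real assume st: "s \<in> X" "t \<in> X" and e: "0 < e"
  obtain a where a: "a > 0" "\<And>x. x \<in> X \<Longrightarrow> dist x s < a \<Longrightarrow> d x s < e / 2"
    using loc[OF st(1), of "e/2"] e by auto
  obtain b where b: "b > 0" "\<And>x. x \<in> X \<Longrightarrow> dist x t < b \<Longrightarrow> d x t < e / 2"
    using loc[OF st(2), of "e/2"] e by auto
  show "\<exists>r>0. \<forall>x\<in>X. \<forall>y\<in>X. dist (x, y) (s, t) < r \<longrightarrow> dist (d x y) (d s t) < e"
  proof (intro exI[of _ "min a b"] conjI ballI impI)
    show "min a b > 0" using a b by simp
    fix x y assume xy: "x \<in> X" "y \<in> X" "dist (x, y) (s, t) < min a b"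
    have "dist x s < a" "dist y t < b"
      using xy(3) dist_fst_le[of "(x, y)" "(s, t)"] dist_snd_le[of "(x, y)" "(s, t)"] by auto
    then have "d x s < e / 2" "d y t < e / 2" using a b xy by auto
    then show "dist (d x y) (d s t) < e"
      using pseudo_dist_on_diff_le[OF pd xy(1,2) st] by (simp add: dist_real_def)
  qed
qed

text \<open>\<open>d\<close> is continuous at \<open>(x, x)\<close> and vanishes there, so a
  neighbourhood of \<open>x\<close> is projected into any given ball around the class of
  \<open>x\<close>.\<close>

lemma continuous_map_quot_proj:
  fixes d :: "'a :: metric_space \<Rightarrow> 'a \<Rightarrow> real"
  assumes pd: "pseudo_dist_on X d" and cont: "continuous_on (X \<times> X) (\<lambda>(s, t). d s t)"
  shows "continuous_map (top_of_set X)
    (Metric_space.mtopology (X // zero_rel X d) (quot_dist X d)) (quot_proj X d)"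
proof -
  interpret Q: Metric_space "X // zero_rel X d" "quot_dist X d"
    by (rule Metric_space_quot[OF pd])
  have in_Q: "quot_proj X d x \<in> X // zero_rel X d" if "x \<in> X" for x
    using that by (auto simp: quot_proj_def intro: quotientI)
  show ?thesis
    unfolding Q.continuous_map_to_metric
  proof (intro ballI allI impI, goal_cases)
    case (1 x e)
    then have x: "x \<in> X" and e: "e > 0" by auto
    obtain r where r: "r > 0"
      "\<And>u v. u \<in> X \<Longrightarrow> v \<in> X \<Longrightarrow> dist (u, v) (x, x) < r \<Longrightarrow> dist (d u v) (d x x) < e"
      using cont x e unfolding continuous_on_iff by fastforce
    have near: "quot_proj X d y \<in> Q.mball (quot_proj X d x) e" if y: "y \<in> X \<inter> ball x r" for y
    proof -
      have "dist (x, y) (x, x) < r" using y by (simp add: dist_Pair_Pair dist_commute)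
      then have "d x y < e"
        using r(2)[of x y] x y pseudo_dist_onD(1,2)[OF pd x, of y] by (simp add: dist_real_def)
      then show ?thesis using x y in_Q by (simp add: quot_dist_proj[OF pd])
    qed
    show ?case
      by (rule exI[of _ "X \<inter> ball x r"]) (use near x r in \<open>auto intro: openin_open_Int\<close>)
  qed
qed

section \<open>Borel sigma-algebras and measurability of continuous maps\<close>

lemma space_borel_of [simp]: "space (borel_of T) = topspace T"
  by (simp add: borel_of_def space_measure_of_conv)

lemma sets_borel_of: "sets (borel_of T) = sigma_sets (topspace T) {U. openin T U}"
proof -
  have "{U. openin T U} \<subseteq> Pow (topspace T)" using openin_subset by auto
  then show ?thesis by (simp add: borel_of_def sets_measure_of_conv)
qed

lemma openin_sets_borel_of: "openin T U \<Longrightarrow> U \<in> sets (borel_of T)"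
  by (simp add: sets_borel_of)

lemma measurable_borel_ofI:
  assumes "g \<in> space M \<rightarrow> topspace T"
    and "\<And>U. openin T U \<Longrightarrow> g -` U \<inter> space M \<in> sets M"
  shows "g \<in> M \<rightarrow>\<^sub>M borel_of T"
  unfolding borel_of_def
proof (rule measurable_measure_of)
  show "{U. openin T U} \<subseteq> Pow (topspace T)" using openin_subset by auto
qed (use assms in auto)

lemma continuous_map_measurable_borel_of:
  assumes "continuous_map S T g"
  shows "g \<in> borel_of S \<rightarrow>\<^sub>M borel_of T"
proof (rule measurable_borel_ofI)
  show "g \<in> space (borel_of S) \<rightarrow> topspace T"
    using assms by (simp add: continuous_map_def)
  fix U assume "openin T U"
  moreover have "g -` U \<inter> topspace S = {x \<in> topspace S. g x \<in> U}" by auto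
  ultimately show "g -` U \<inter> space (borel_of S) \<in> sets (borel_of S)"
    using openin_continuous_map_preimage[OF assms, of U] openin_sets_borel_of by simp
qed

text \<open>Preimages of open sets are traces of open sets on \<open>X\<close>, hence Lebesgue
  measurable. The source is \<open>lebesgue_on X\<close> because \<open>coded_space\<close> pushes
  such a measure forward.\<close>

lemma continuous_map_measurable_lebesgue_on:
  fixes X :: "'a :: euclidean_space set"
  assumes "continuous_map (top_of_set X) T g" and "X \<in> sets lebesgue"
  shows "g \<in> lebesgue_on X \<rightarrow>\<^sub>M borel_of T"
proof (rule measurable_borel_ofI)
  show "g \<in> space (lebesgue_on X) \<rightarrow> topspace T"
    using assms by (simp add: continuous_map_def)
  fix U assume "openin T U"
  then have "openin (top_of_set X) {x \<in> X. g x \<in> U}"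
    using openin_continuous_map_preimage[OF assms(1), of U] by simp
  then obtain V where "open V" "{x \<in> X. g x \<in> U} = X \<inter> V"
    by (auto simp: openin_open)
  moreover have "g -` U \<inter> X = {x \<in> X. g x \<in> U}" by auto
  ultimately show "g -` U \<inter> space (lebesgue_on X) \<in> sets (lebesgue_on X)"
    using assms(2) by (auto simp: sets_restrict_space)
qed

section \<open>Bounds on the Gromov-Hausdorff-Prokhorov distance of coded spaces\<close>

lemma coded_space_simps:
  "pw_carrier (coded_space d) = {0..1} // zero_rel {0..1} d"
  "pw_dist (coded_space d) = quot_dist {0..1} d"
  "pw_point (coded_space d) = quot_proj {0..1} d 1"
  "pw_measure (coded_space d) =
     distr (lebesgue_on {0..1}) (borel_of (pw_topology (coded_space d))) (quot_proj {0..1} d)"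
  by (simp_all add: coded_space_def Let_def pw_topology_def)

lemma GHP_dist_nonneg: "0 \<le> GHP_dist X Y"
proof -
  have "0 \<le> max (ereal (1/2) * distortion X Y R) (ereal (1 - measure \<nu> R))"
    if "\<nu> \<in> couplings X Y" for R \<nu>
  proof -
    interpret prob_space \<nu> using that by (simp add: couplings_def)
    show ?thesis by (intro max.coboundedI2) simp
  qed
  then show ?thesis unfolding GHP_dist_def by (auto intro!: INF_greatest)
qed

text \<open>The diagonal correspondence, with the same uniform point projected to both spaces.\<close>

lemma GHP_dist_coded_space_le:
  assumes pd: "pseudo_dist_on {0..1} d" "pseudo_dist_on {0..1} d'"
    and cont: "continuous_on ({0..1} \<times> {0..1}) (\<lambda>(s, t). d s t)"
      "continuous_on ({0..1} \<times> {0..1}) (\<lambda>(s, t). d' s t)"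
    and close: "\<And>s t. s \<in> {0..1} \<Longrightarrow> t \<in> {0..1} \<Longrightarrow> \<bar>d s t - d' s t\<bar> \<le> e"
  shows "GHP_dist (coded_space d) (coded_space d') \<le> ereal e"
proof -
  let ?I = "{0..1::real}" and ?X = "coded_space d" and ?Y = "coded_space d'"
  let ?p = "quot_proj {0..1} d" and ?q = "quot_proj {0..1} d'"
  let ?TX = "pw_topology ?X" and ?TY = "pw_topology ?Y"
  let ?M = "lebesgue_on ?I" and ?h = "\<lambda>s. (?p s, ?q s)"
  interpret X: Metric_space "?I // zero_rel ?I d" "quot_dist ?I d"
    by (rule Metric_space_quot[OF pd(1)])
  interpret Y: Metric_space "?I // zero_rel ?I d'" "quot_dist ?I d'"
    by (rule Metric_space_quot[OF pd(2)])
  have TX: "?TX = X.mtopology" and TY: "?TY = Y.mtopology"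
    by (simp_all add: pw_topology_def coded_space_simps)
  have cp: "continuous_map (top_of_set ?I) ?TX ?p" and cq: "continuous_map (top_of_set ?I) ?TY ?q"
    unfolding TX TY using continuous_map_quot_proj[OF pd(1) cont(1)]
      continuous_map_quot_proj[OF pd(2) cont(2)] by auto
  have ch: "continuous_map (top_of_set ?I) (prod_topology ?TX ?TY) ?h"
    using cp cq by (simp add: continuous_map_pairedI)
  have im: "?p ` ?I = ?I // zero_rel ?I d" "?q ` ?I = ?I // zero_rel ?I d'"
    by (auto simp: quot_proj_def quotient_def)
  define R where "R = ?h ` ?I"
  define \<nu> where "\<nu> = distr ?M (borel_of (prod_topology ?TX ?TY)) ?h"
  have mh: "?h \<in> ?M \<rightarrow>\<^sub>M borel_of (prod_topology ?TX ?TY)"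
    by (rule continuous_map_measurable_lebesgue_on[OF ch]) simp
  have prob: "prob_space ?M"
    by (rule prob_spaceI) (simp add: emeasure_restrict_space)
  have \<nu>_prob: "prob_space \<nu>"
    unfolding \<nu>_def by (rule prob_space.prob_space_distr[OF prob mh])
  have R_compact: "compactin (prod_topology ?TX ?TY) R"
    unfolding R_def by (rule image_compactin[OF _ ch]) (simp add: compactin_subtopology)
  have "R \<in> compact_correspondences ?X ?Y"
    using R_compact im by (auto simp: compact_correspondences_def coded_space_simps R_def image_image)
  moreover have "(pw_point ?X, pw_point ?Y) \<in> R"
    by (auto simp: R_def coded_space_simps)
  moreover have "\<nu> \<in> couplings ?X ?Y"
  proof -
    have mf: "fst \<in> borel_of (prod_topology ?TX ?TY) \<rightarrow>\<^sub>M borel_of ?TX"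
      and ms: "snd \<in> borel_of (prod_topology ?TX ?TY) \<rightarrow>\<^sub>M borel_of ?TY"
      by (auto intro!: continuous_map_measurable_borel_of continuous_map_fst continuous_map_snd)
    have "distr \<nu> (borel_of ?TX) fst = pw_measure ?X"
      unfolding \<nu>_def by (subst distr_distr[OF mf mh]) (simp add: coded_space_simps comp_def)
    moreover have "distr \<nu> (borel_of ?TY) snd = pw_measure ?Y"
      unfolding \<nu>_def by (subst distr_distr[OF ms mh]) (simp add: coded_space_simps comp_def)
    moreover have "space \<nu> = pw_carrier ?X \<times> pw_carrier ?Y"
      by (simp add: \<nu>_def TX TY coded_space_simps)
    ultimately show ?thesis using \<nu>_prob by (simp add: couplings_def \<nu>_def)
  qed
  ultimately have "GHP_dist ?X ?Y \<le> max (ereal (1/2) * distortion ?X ?Y R) (ereal (1 - measure \<nu> R))"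
    unfolding GHP_dist_def by (intro INF_lower2[of "(R, \<nu>)"]) auto
  also have "\<dots> \<le> ereal e"
  proof (rule max.boundedI)
    \<comment> \<open>Closeness at a single pair of points already forces \<open>e\<close> to be
      nonnegative; this allows the factor 1/2 to be dropped and the zero mass defect to be bounded
      by \<open>e\<close>.\<close>
    have e: "0 \<le> e" using close[of 0 0] by simp
    have "distortion ?X ?Y R \<le> ereal e"
      unfolding distortion_def R_def
      by (rule SUP_least) (auto simp: coded_space_simps quot_dist_proj[OF pd(1)] quot_dist_proj[OF pd(2)]
        intro!: close)
    then have "ereal (1/2) * distortion ?X ?Y R \<le> ereal (1/2) * ereal e"
      by (intro ereal_mult_left_mono) auto
    also have "\<dots> \<le> ereal e" using e by simp
    finally show "ereal (1/2) * distortion ?X ?Y R \<le> ereal e" .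
    \<comment> \<open>The mass of \<open>R\<close> can be computed once \<open>R\<close> is Borel:
      compact in a Hausdorff product, it is closed, hence the complement of a generator.\<close>
    have "Hausdorff_space (prod_topology ?TX ?TY)"
      unfolding TX TY by (simp add: Hausdorff_space_prod_topology X.Hausdorff_space_mtopology
        Y.Hausdorff_space_mtopology)
    then have "closedin (prod_topology ?TX ?TY) R"
      using R_compact compactin_imp_closedin by blast
    then have "space (borel_of (prod_topology ?TX ?TY)) - R \<in> sets (borel_of (prod_topology ?TX ?TY))"
      by (simp add: openin_sets_borel_of closedin_def)
    then have "space (borel_of (prod_topology ?TX ?TY)) - (space (borel_of (prod_topology ?TX ?TY)) - R)
        \<in> sets (borel_of (prod_topology ?TX ?TY))"
      by (rule sets.compl_sets)
    moreover have "R \<subseteq> space (borel_of (prod_topology ?TX ?TY))"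
      using compactin_subset_topspace[OF R_compact] by simp
    ultimately have R_sets: "R \<in> sets (borel_of (prod_topology ?TX ?TY))"
      by (simp add: double_diff)
    \<comment> \<open>Both coordinates come from the same point of \<open>[0,1]\<close>, so the pair
      always lies in \<open>R\<close> and the coupling has full mass.\<close>
    have "?h -` R \<inter> space ?M = space ?M" by (auto simp: R_def)
    then have "measure \<nu> R = 1"
      unfolding \<nu>_def measure_distr[OF mh R_sets] using prob_space.prob_space[OF prob] by simp
    then show "ereal (1 - measure \<nu> R) \<le> ereal e" using e by simp
  qed
  finally show ?thesis .
qed

lemma GHP_dist_coded_space_tendsto:
  assumes "\<And>n. pseudo_dist_on {0..1} (D n)" "pseudo_dist_on {0..1} d"
    and "\<And>n. continuous_on ({0..1} \<times> {0..1}) (\<lambda>(s, t). D n s t)"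
    and "continuous_on ({0..1} \<times> {0..1}) (\<lambda>(s, t). d s t)"
    and unif: "\<And>e. 0 < e \<Longrightarrow> \<forall>\<^sub>F n in sequentially. \<forall>s\<in>{0..1}. \<forall>t\<in>{0..1}. \<bar>D n s t - d s t\<bar> \<le> e"
  shows "(\<lambda>n. GHP_dist (coded_space (D n)) (coded_space d)) \<longlonglongrightarrow> 0"
proof (rule order_tendstoI)
  fix a :: ereal assume "a < 0"
  then show "\<forall>\<^sub>F n in sequentially. a < GHP_dist (coded_space (D n)) (coded_space d)"
    by (intro always_eventually allI) (rule less_le_trans[OF _ GHP_dist_nonneg])
next
  fix a :: ereal assume "0 < a"
  then obtain e where e: "0 < ereal e" "ereal e < a" using ereal_dense2[of 0 a] by auto
  then have "\<forall>\<^sub>F n in sequentially. \<forall>s\<in>{0..1}. \<forall>t\<in>{0..1}. \<bar>D n s t - d s t\<bar> \<le> e"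
    using unif[of e] by simp
  then show "\<forall>\<^sub>F n in sequentially. GHP_dist (coded_space (D n)) (coded_space d) < a"
  proof eventually_elim
    case (elim n)
    then have "GHP_dist (coded_space (D n)) (coded_space d) \<le> ereal e"
      using assms by (intro GHP_dist_coded_space_le) auto
    then show ?case using e by simp
  qed
qed

section \<open>Unconditional sums\<close>

lemma
  fixes g h :: "'a \<Rightarrow> real"
  assumes "g summable_on A" "h summable_on A"
  shows summable_on_diff: "(\<lambda>x. g x - h x) summable_on A"
    and infsum_diff: "infsum (\<lambda>x. g x - h x) A = infsum g A - infsum h A"
  using summable_on_add[OF assms(1) summable_on_uminus[THEN iffD2, OF assms(2)]]
    infsum_add[OF assms(1) summable_on_uminus[THEN iffD2, OF assms(2)]]
  by (simp_all add: infsum_uminus)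

text \<open>Terms in the finite set \<open>S\<close> are compared one by one at a cost of
  \<open>\<kappa>\<close> each; the others are absorbed by \<open>c\<close>, whose finite partial
  sums are at most \<open>\<eta>\<close>. In the application \<open>\<kappa>\<close> is a multiple
  of the Skorokhod error, while \<open>card S\<close> stays bounded.\<close>

lemma infsum_diff_le_of_finite_sums:
  fixes a b :: "'a \<Rightarrow> real"
  assumes "a summable_on X" "b summable_on X"
    and S: "finite S" "\<And>r. r \<in> X \<inter> S \<Longrightarrow> \<bar>a r - b r\<bar> \<le> \<kappa>" "0 \<le> \<kappa>"
    and tail: "\<And>r. r \<in> X - S \<Longrightarrow> \<bar>a r - b r\<bar> \<le> c r"
      "\<And>A. finite A \<Longrightarrow> A \<subseteq> X - S \<Longrightarrow> sum c A \<le> \<eta>"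
  shows "\<bar>infsum a X - infsum b X\<bar> \<le> real (card S) * \<kappa> + \<eta>"
proof -
  have fin: "(\<Sum>r\<in>A. \<bar>a r - b r\<bar>) \<le> real (card S) * \<kappa> + \<eta>" if A: "finite A" "A \<subseteq> X" for A
  proof -
    have "(\<Sum>r\<in>A. \<bar>a r - b r\<bar>) = (\<Sum>r\<in>A \<inter> S. \<bar>a r - b r\<bar>) + (\<Sum>r\<in>A - S. \<bar>a r - b r\<bar>)"
      using A sum.Int_Diff by blast
    also have "(\<Sum>r\<in>A \<inter> S. \<bar>a r - b r\<bar>) \<le> (\<Sum>r\<in>A \<inter> S. \<kappa>)"
      using S A by (intro sum_mono) auto
    also have "\<dots> \<le> real (card S) * \<kappa>"
      using S by (auto intro!: mult_right_mono card_mono)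
    also have "(\<Sum>r\<in>A - S. \<bar>a r - b r\<bar>) \<le> sum c (A - S)"
      using tail(1) A by (intro sum_mono) auto
    also have "\<dots> \<le> \<eta>" using tail(2)[of "A - S"] A by auto
    finally show ?thesis by simp
  qed
  \<comment> \<open>The pair \<open>u\<close>, \<open>v\<close> is generic so that the one-sided
    bound can be used with \<open>a\<close> and \<open>b\<close> in either order.\<close>
  have one: "infsum u X - infsum v X \<le> real (card S) * \<kappa> + \<eta>"
    if "u summable_on X" "v summable_on X" "\<And>r. \<bar>u r - v r\<bar> = \<bar>a r - b r\<bar>" for u v :: "'a \<Rightarrow> real"
  proof -
    have "infsum (\<lambda>r. u r - v r) X \<le> real (card S) * \<kappa> + \<eta>"
    proof (rule infsum_le_finite_sums)
      fix A assume A: "finite A" "A \<subseteq> X"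
      have "(\<Sum>r\<in>A. u r - v r) \<le> (\<Sum>r\<in>A. \<bar>a r - b r\<bar>)"
        using that(3) by (intro sum_mono) (metis abs_ge_self)
      then show "(\<Sum>r\<in>A. u r - v r) \<le> real (card S) * \<kappa> + \<eta>" using fin[OF A] by simp
    qed (intro summable_on_diff that)
    then show ?thesis by (simp add: infsum_diff that)
  qed
  show ?thesis using one[of a b] one[of b a] assms(1,2) by (simp add: abs_minus_commute abs_le_iff)
qed

lemma finite_set_pos_lower_bound:
  fixes h :: "'a \<Rightarrow> real"
  assumes "finite G" "\<And>r. r \<in> G \<Longrightarrow> 0 < h r"
  obtains \<kappa> where "0 < \<kappa>" "\<And>r. r \<in> G \<Longrightarrow> \<kappa> \<le> h r"
proof (cases "G = {}")
  case True
  then show ?thesis using that[of 1] by auto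
next
  case False
  then show ?thesis using that[of "Min (h ` G)"] assms by auto
qed

section \<open>Excursions\<close>

lemma
  assumes "excursion f"
  shows excursion_nonneg: "t \<in> {-1..1} \<Longrightarrow> 0 \<le> f t"
    and excursion_right: "t \<in> {-1..<1} \<Longrightarrow> (f \<longlongrightarrow> f t) (at_right t)"
    and excursion_zero: "t \<in> {-1..<0} \<Longrightarrow> f t = 0" "f 1 = 0"
  using assms by (auto simp: excursion_def cadlag_def)

lemma excursion_left:
  assumes "excursion f" "t \<in> {-1<..1}"
  shows "(f \<longlongrightarrow> left_lim f t) (at_left t)"
proof -
  obtain l where l: "(f \<longlongrightarrow> l) (at_left t)"
    using assms unfolding excursion_def cadlag_def by blast
  then have "left_lim f t = l" unfolding left_lim_def by (intro tendsto_Lim) auto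
  with l show ?thesis by simp
qed

lemma eventually_at_left_in_domain:
  fixes t :: real
  assumes "a < t" shows "\<forall>\<^sub>F u in at_left t. u \<in> {a<..<t}"
  using assms eventually_at_left_real by blast

lemma left_lim_nonneg:
  assumes f: "excursion f" and t: "t \<in> {-1<..1}"
  shows "0 \<le> left_lim f t"
proof (rule tendsto_lowerbound[OF excursion_left[OF f t]])
  show "\<forall>\<^sub>F u in at_left t. 0 \<le> f u"
    using eventually_at_left_in_domain[of "-1" t] t
    by (auto elim!: eventually_mono intro!: excursion_nonneg[OF f])
qed simp

lemma left_lim_neg:
  assumes f: "excursion f" and t: "t \<in> {-1<..0}"
  shows "left_lim f t = 0"
proof -
  have "\<forall>\<^sub>F u in at_left t. f u = 0"
    using eventually_at_left_in_domain[of "-1" t] t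
    by (auto elim!: eventually_mono intro!: excursion_zero[OF f])
  then have "(f \<longlongrightarrow> 0) (at_left t)" by (rule tendsto_eventually)
  then show ?thesis using tendsto_unique[OF _ excursion_left[OF f]] t by force
qed

lemma jump_neg: "excursion f \<Longrightarrow> t \<in> {-1<..<0} \<Longrightarrow> jump f t = 0"
  by (simp add: jump_def left_lim_neg excursion_zero)

lemma jump_nonneg:
  assumes f: "excursion f" and t: "t \<in> {-1<..1}"
  shows "0 \<le> jump f t"
  using assms jump_neg[OF f, of t] by (cases "t < 0") (auto simp: excursion_def)

lemma left_lim_le: "excursion f \<Longrightarrow> t \<in> {-1<..1} \<Longrightarrow> left_lim f t \<le> f t"
  using jump_nonneg[of f t] by (simp add: jump_def)

lemma excursion_INF_lower:
  assumes f: "excursion f" and "{s..t} \<subseteq> {-1..1}" "u \<in> {s..t}"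
  shows "(INF u\<in>{s..t}. f u) \<le> f u"
  by (rule cINF_lower) (use assms excursion_nonneg[OF f] in \<open>auto intro!: bdd_belowI2[of _ 0]\<close>)

lemma INF_interval_greatest:
  fixes f :: "real \<Rightarrow> real"
  assumes "s \<le> t" "\<And>u. u \<in> {s..t} \<Longrightarrow> c \<le> f u"
  shows "c \<le> (INF u\<in>{s..t}. f u)"
  by (rule cINF_greatest) (use assms in auto)

lemma excursion_INF_split:
  assumes f: "excursion f" and "-1 \<le> r" "r \<le> s" "s \<le> t" "t \<le> 1"
  shows "(INF u\<in>{r..t}. f u) = min (INF u\<in>{r..s}. f u) (INF u\<in>{s..t}. f u)"
proof (rule antisym)
  have "(INF u\<in>{r..t}. f u) \<le> (INF u\<in>{r..s}. f u)" "(INF u\<in>{r..t}. f u) \<le> (INF u\<in>{s..t}. f u)"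
    using assms by (auto intro!: INF_interval_greatest excursion_INF_lower[OF f])
  then show "(INF u\<in>{r..t}. f u) \<le> min (INF u\<in>{r..s}. f u) (INF u\<in>{s..t}. f u)" by simp
  show "min (INF u\<in>{r..s}. f u) (INF u\<in>{s..t}. f u) \<le> (INF u\<in>{r..t}. f u)"
  proof (rule INF_interval_greatest)
    fix u assume "u \<in> {r..t}"
    then show "min (INF u\<in>{r..s}. f u) (INF u\<in>{s..t}. f u) \<le> f u"
      using excursion_INF_lower[OF f, of r s u] excursion_INF_lower[OF f, of s t u] assms
      by (cases "u \<le> s") auto
  qed (use assms in auto)
qed

text \<open>Since \<open>s < r\<close>, the times just before \<open>r\<close> belong to
  \<open>{s..t}\<close>, and the bound at these times passes to the left limit.\<close>

lemma excursion_INF_le_left_lim: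
  assumes f: "excursion f" and "-1 \<le> s" "s < r" "r \<le> t" "t \<le> 1"
  shows "(INF u\<in>{s..t}. f u) \<le> left_lim f r"
proof (rule tendsto_lowerbound[OF excursion_left[OF f]])
  show "\<forall>\<^sub>F u in at_left r. (INF u\<in>{s..t}. f u) \<le> f u"
    using eventually_at_left_in_domain[of s r] assms
    by (auto elim!: eventually_mono intro!: excursion_INF_lower[OF f])
qed (use assms in auto)

section \<open>The processes \<open>xproc\<close> and their disjoint level intervals\<close>

lemma xproc_nonneg [simp]: "0 \<le> xproc f r t"
  by (simp add: xproc_def)

lemma xproc_before [simp]: "t < r \<Longrightarrow> xproc f r t = 0"
  by (simp add: xproc_def)

lemma xproc_le_jump:
  assumes f: "excursion f" and "r \<in> {-1<..1}" "t \<in> {-1..1}"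
  shows "xproc f r t \<le> jump f r"
proof (cases "r \<le> t")
  case True
  then show ?thesis
    using excursion_INF_lower[OF f, of r t r] jump_nonneg[OF f, of r] assms
    by (auto simp: xproc_def jump_def)
qed (use jump_nonneg[OF f, of r] assms in simp)

lemma xproc_no_jump:
  assumes "excursion f" "r \<in> {-1<..1}" "t \<in> {-1..1}" "jump f r = 0"
  shows "xproc f r t = 0"
  using xproc_le_jump[OF assms(1-3)] xproc_nonneg[of f r t] assms(4) by linarith

lemma xproc_self: "excursion f \<Longrightarrow> r \<in> {-1<..1} \<Longrightarrow> xproc f r r = jump f r"
  using jump_nonneg[of f r] by (simp add: xproc_def jump_def)

lemma xproc_le:
  assumes f: "excursion f" and "r \<in> {-1<..1}" "t \<in> {-1..1}"
  shows "xproc f r t \<le> max (f t - left_lim f r) 0"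
  using excursion_INF_lower[OF f, of r t t] assms by (auto simp: xproc_def)

text \<open>The infimum over \<open>{r..t}\<close> splits at \<open>s\<close>, and subtracting
  \<open>left_lim f r\<close> and truncating at 0 is monotone. From time \<open>r\<close> on the
  process is thus nonincreasing: later infima can only cut it from above.\<close>

lemma xproc_min:
  assumes f: "excursion f" and "-1 < r" "r \<le> s" "s \<le> t" "t \<le> 1"
  shows "xproc f r t = min (xproc f r s) (max ((INF u\<in>{s..t}. f u) - left_lim f r) 0)"
  using excursion_INF_split[OF f, of r s t] assms by (auto simp: xproc_def)

text \<open>When \<open>xproc f r t\<close> is positive, \<open>left_lim f r + xproc f r t\<close>
  is the infimum over \<open>{r..t}\<close>, which also bounds the values just before
  \<open>r'\<close>. Level intervals are therefore stacked in the order of the jump times.\<close>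

lemma xproc_disjoint:
  assumes f: "excursion f" and "-1 < r" "r < r'" "r' \<le> t" "t \<le> 1" and "0 < xproc f r t"
  shows "left_lim f r + xproc f r t \<le> left_lim f r'"
  using excursion_INF_le_left_lim[OF f, of r r' t] assms by (auto simp: xproc_def split: if_splits)

text \<open>\<open>min (x r) (max (b - l r) 0)\<close> is the length of the part below level
  \<open>b\<close> of the interval from \<open>l r\<close> to \<open>l r + x r\<close>. The sum
  measures what disjoint intervals cover between \<open>a\<close> and \<open>b\<close>.\<close>

lemma sum_disjoint_intervals_le:
  fixes l x :: "'a :: linorder \<Rightarrow> real"
  assumes "finite A" "\<And>r. r \<in> A \<Longrightarrow> 0 \<le> x r"
    and "\<And>r r'. r \<in> A \<Longrightarrow> r' \<in> A \<Longrightarrow> r < r' \<Longrightarrow> 0 < x r \<Longrightarrow> 0 < x r' \<Longrightarrow> l r + x r \<le> l r'"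
    and "a \<le> b"
  shows "(\<Sum>r\<in>A. min (x r) (max (b - l r) 0) - min (x r) (max (a - l r) 0)) \<le> b - a"
  using assms
proof (induction A arbitrary: b rule: finite_linorder_max_induct)
  case empty
  then show ?case by simp
next
  case (insert k A)
  let ?y = "\<lambda>c r. min (x r) (max (c - l r) 0)"
  show ?case
  proof (cases "x k = 0")
    case True
    then have "?y b k - ?y a k = 0" by (auto simp: min_def max_def)
    then have "(\<Sum>r\<in>insert k A. ?y b r - ?y a r) = (\<Sum>r\<in>A. ?y b r - ?y a r)"
      using insert by (subst sum.insert) auto
    also have "\<dots> \<le> b - a" using insert by auto
    finally show ?thesis .
  next
    case False
    then have k: "0 < x k" using insert.prems(1)[of k] by simp
    \<comment> \<open>The top interval covers at most the part from \<open>c\<close> to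
      \<open>b\<close>. The nonempty intervals of \<open>A\<close> end at or below
      \<open>l k\<close>, so lowering their cut from \<open>b\<close> to \<open>c\<close> changes
      nothing, and the induction hypothesis applies at level \<open>c\<close>.\<close>
    define c where "c = min b (max a (l k))"
    have c: "a \<le> c" "c \<le> b" using insert.prems by (auto simp: c_def)
    have "?y b r = ?y c r" if r: "r \<in> A" for r
    proof (cases "x r = 0")
      case False
      then have "l r + x r \<le> l k"
        using insert.prems(1)[of r] insert.prems(2)[of r k] insert.hyps r k by force
      then show ?thesis by (auto simp: c_def min_def max_def)
    qed (auto simp: min_def max_def)
    then have "(\<Sum>r\<in>A. ?y b r - ?y a r) = (\<Sum>r\<in>A. ?y c r - ?y a r)" by simp
    also have "\<dots> \<le> c - a" using insert c by auto
    moreover have "?y b k - ?y a k \<le> b - c"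
      using c k by (auto simp: c_def min_def max_def)
    ultimately show ?thesis using insert by (subst sum.insert) auto
  qed
qed

lemma sum_xproc_level_le:
  assumes f: "excursion f" and A: "finite A" "A \<subseteq> {-1<..1}" and t: "t \<in> {-1..1}" and ab: "a \<le> b"
  shows "(\<Sum>r\<in>A. min (xproc f r t) (max (b - left_lim f r) 0)
            - min (xproc f r t) (max (a - left_lim f r) 0)) \<le> b - a"
proof (rule sum_disjoint_intervals_le)
  fix r r' assume r: "r \<in> A" "r' \<in> A" "r < r'" "0 < xproc f r t" "0 < xproc f r' t"
  then have "r' \<le> t" using xproc_before[of t r' f] by (cases "t < r'") auto
  then show "left_lim f r + xproc f r t \<le> left_lim f r'"
    using r A t by (intro xproc_disjoint[OF f]) auto
qed (use assms in auto)

text \<open>All level intervals lie between 0 and \<open>f t\<close>, so cutting at these two levels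
  retains their full lengths.\<close>

lemma sum_xproc_le:
  assumes f: "excursion f" and A: "finite A" "A \<subseteq> {-1<..1}" and t: "t \<in> {-1..1}"
  shows "(\<Sum>r\<in>A. xproc f r t) \<le> f t"
proof -
  have "min (xproc f r t) (max (f t - left_lim f r) 0) - min (xproc f r t) (max (0 - left_lim f r) 0)
      = xproc f r t" if "r \<in> A" for r
    using xproc_le[OF f, of r t] left_lim_nonneg[OF f, of r] xproc_nonneg[of f r t] that A t
    by (auto simp: min_def max_def subset_eq simp del: xproc_nonneg)
  then have "(\<Sum>r\<in>A. xproc f r t) = (\<Sum>r\<in>A. min (xproc f r t) (max (f t - left_lim f r) 0)
      - min (xproc f r t) (max (0 - left_lim f r) 0))" by simp
  also have "\<dots> \<le> f t - 0"
    using assms excursion_nonneg[OF f t] by (intro sum_xproc_level_le) auto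
  finally show ?thesis by simp
qed

lemma summable_xproc:
  assumes f: "excursion f" and t: "t \<in> {-1..1}"
  shows "(\<lambda>r. xproc f r t) summable_on {-1<..1}"
  by (rule nonneg_bdd_above_summable_on)
    (auto intro!: bdd_aboveI2[of _ _ "f t"] sum_xproc_le[OF f _ _ t])

lemma summable_xproc_dominated:
  fixes h :: "real \<Rightarrow> real"
  assumes f: "excursion f" and st: "s \<in> {-1..1}" "t \<in> {-1..1}"
    and h: "\<And>r. r \<in> {-1<..1} \<Longrightarrow> \<bar>h r\<bar> \<le> xproc f r s + xproc f r t"
  shows "h summable_on {-1<..1}"
proof -
  have "(\<lambda>r. xproc f r s + xproc f r t) summable_on {-1<..1}"
    by (intro summable_on_add summable_xproc assms)
  then have "(\<lambda>r. norm (h r)) summable_on {-1<..1}"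
    by (rule summable_on_comparison_test) (use h in auto)
  then show ?thesis by (rule abs_summable_summable)
qed

text \<open>The definitions sum over \<open>[0,1]\<close>, a set that a time change need not
  preserve. It does preserve \<open>{-1<..1}\<close>, and the added terms vanish because excursions
  do not jump at negative times.\<close>

lemma infsum_extend_domain:
  fixes h :: "real \<Rightarrow> real"
  assumes "\<And>r. r \<in> {-1<..<0} \<Longrightarrow> h r = 0"
  shows "(\<Sum>\<^sub>\<infinity>r\<in>{0..1}. h r) = (\<Sum>\<^sub>\<infinity>r\<in>{-1<..1}. h r)"
  by (rule infsum_cong_neutral) (use assms in auto)

lemma xproc_neg: "excursion f \<Longrightarrow> r \<in> {-1<..<0} \<Longrightarrow> t \<in> {-1..1} \<Longrightarrow> xproc f r t = 0"
  using xproc_no_jump[of f r t] jump_neg[of f r] by auto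

lemma pure_jump_part_extend:
  assumes f: "excursion f" and t: "t \<in> {-1..1}"
  shows "pure_jump_part f t = (\<Sum>\<^sub>\<infinity>r\<in>{-1<..1}. xproc f r t)"
  unfolding pure_jump_part_def by (rule infsum_extend_domain) (use assms in \<open>simp add: xproc_neg\<close>)

section \<open>One-sided neighbourhoods and compactness arguments on \<open>[-1,1]\<close>\<close>

lemma excursion_near_left:
  assumes f: "excursion f" and t: "t \<in> {-1<..1}" and e: "0 < e"
  obtains \<delta> where "0 < \<delta>" "\<And>u. u \<in> {-1..1} \<Longrightarrow> t - \<delta> < u \<Longrightarrow> u < t \<Longrightarrow> \<bar>f u - left_lim f t\<bar> < e"
proof -
  have "\<forall>\<^sub>F u in at_left t. dist (f u) (left_lim f t) < e"
    using tendstoD[OF excursion_left[OF f t] e] .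
  then obtain b where b: "b < t" "\<And>u. b < u \<Longrightarrow> u < t \<Longrightarrow> dist (f u) (left_lim f t) < e"
    unfolding eventually_at_left_field by blast
  show ?thesis by (rule that[of "t - b"]) (use b in \<open>auto simp: dist_real_def\<close>)
qed

lemma excursion_near_right:
  assumes f: "excursion f" and t: "t \<in> {-1..1}" and e: "0 < e"
  obtains \<delta> where "0 < \<delta>" "\<And>u. u \<in> {-1..1} \<Longrightarrow> t \<le> u \<Longrightarrow> u < t + \<delta> \<Longrightarrow> \<bar>f u - f t\<bar> < e"
proof (cases "t = 1")
  case True
  have "\<bar>f u - f t\<bar> < e" if "u \<in> {-1..1}" "t \<le> u" for u
  proof -
    have "u = t" using that True by auto
    then show ?thesis using e by simp
  qed
  then show ?thesis using that[of 1] by auto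
next
  case False
  then have "\<forall>\<^sub>F u in at_right t. dist (f u) (f t) < e"
    using tendstoD[OF excursion_right[OF f] e] t by auto
  then obtain b where b: "b > t" "\<And>u. t < u \<Longrightarrow> u < b \<Longrightarrow> dist (f u) (f t) < e"
    unfolding eventually_at_right_field by blast
  have "\<bar>f u - f t\<bar> < e" if "t \<le> u" "u < b" for u
    using b(2)[of u] that e by (cases "u = t") (auto simp: dist_real_def)
  then show ?thesis using that[of "b - t"] b by auto
qed

text \<open>One-sided limits bound \<open>f\<close> near each point, and bounds on adjacent
  intervals combine, so bisection applies. The intersection with \<open>{-1..1}\<close> appears
  because the intervals tested near an end point may stick out.\<close>

lemma excursion_bounded:
  assumes f: "excursion f"
  obtains B where "\<And>t. t \<in> {-1..1} \<Longrightarrow> f t \<le> B"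
proof -
  define P where "P a b \<longleftrightarrow> (\<exists>B. \<forall>t\<in>{a..b} \<inter> {-1..1}. f t \<le> B)" for a b
  have "P (-1) 1"
  proof (rule Bolzano)
    fix a b c :: real assume "P a b" "P b c" "a \<le> b" "b \<le> c"
    then obtain B C where "\<And>t. t \<in> {a..b} \<inter> {-1..1} \<Longrightarrow> f t \<le> B"
      "\<And>t. t \<in> {b..c} \<inter> {-1..1} \<Longrightarrow> f t \<le> C" unfolding P_def by blast
    then have "f t \<le> max B C" if "t \<in> {a..c} \<inter> {-1..1}" for t
      using that by (cases "t \<le> b") (auto simp: le_max_iff_disj)
    then show "P a c" unfolding P_def by blast
  next
    fix x :: real assume "-1 \<le> x" "x \<le> 1"
    then have x: "x \<in> {-1..1}" by simp
    obtain \<delta> where \<delta>: "0 < \<delta>" "\<And>u. u \<in> {-1..1} \<Longrightarrow> x \<le> u \<Longrightarrow> u < x + \<delta> \<Longrightarrow> \<bar>f u - f x\<bar> < 1"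
      using excursion_near_right[OF f x zero_less_one] by blast
    obtain \<gamma> where \<gamma>: "0 < \<gamma>" "\<And>u. u \<in> {-1..1} \<Longrightarrow> x - \<gamma> < u \<Longrightarrow> u < x \<Longrightarrow> \<bar>f u - left_lim f x\<bar> < 1"
    proof (cases "x = -1")
      case True
      then show ?thesis using that[of 1] by auto
    next
      case False
      then show ?thesis using excursion_near_left[OF f _ zero_less_one, of x] x that by auto
    qed
    have "f u \<le> max (f x) (left_lim f x) + 1" if "u \<in> {-1..1}" "x - \<gamma> < u" "u < x + \<delta>" for u
      using \<delta>(2)[of u] \<gamma>(2)[of u] that by (cases "u < x") auto
    then have "P a b" if "a \<le> x" "x \<le> b" "b - a < min \<gamma> \<delta>" for a b
      using that unfolding P_def by (intro exI[of _ "max (f x) (left_lim f x) + 1"]) auto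
    then show "\<exists>d>0. \<forall>a b. a \<le> x \<and> x \<le> b \<and> b - a < d \<longrightarrow> P a b"
      using \<delta>(1) \<gamma>(1) by (intro exI[of _ "min \<gamma> \<delta>"]) auto
  qed simp
  then obtain B where "\<forall>t\<in>{-1..1} \<inter> {-1..1}. f t \<le> B" unfolding P_def by blast
  then show ?thesis by (intro that[of B]) simp
qed

text \<open>A Dini argument despite the jumps. At \<open>x\<close>, finitely many jumps nearly
  exhaust \<open>f x\<close>. To the right, right-continuity keeps each term from dropping much. To
  the left, \<open>f\<close> loses \<open>jump f x\<close> in the limit and the finite sum loses at
  most as much. Bisection glues the local sets.\<close>

lemma PJG_uniform:
  assumes pjg: "PJG f" and \<eta>: "0 < \<eta>"
  obtains S where "finite S" "S \<subseteq> {-1<..1}"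
    "\<And>t. t \<in> {-1..1} \<Longrightarrow> f t - (\<Sum>r\<in>S. xproc f r t) \<le> \<eta>"
proof -
  have f: "excursion f" using pjg by (simp add: PJG_def)
  define k where "k S t = (\<Sum>r\<in>S. xproc f r t)" for S t
  have k_mono: "k S t \<le> k T t" if "finite T" "S \<subseteq> T" for S T t
    unfolding k_def using that by (intro sum_mono2) auto
  define P where "P a b \<longleftrightarrow>
    (\<exists>S. finite S \<and> S \<subseteq> {-1<..1} \<and> (\<forall>t\<in>{a..b} \<inter> {-1..1}. f t - k S t \<le> \<eta>))" for a b
  have "P (-1) 1"
  proof (rule Bolzano)
    fix a b c :: real assume "P a b" "P b c" "a \<le> b" "b \<le> c"
    then obtain S T where S: "finite S" "S \<subseteq> {-1<..1}" "\<And>t. t \<in> {a..b} \<inter> {-1..1} \<Longrightarrow> f t - k S t \<le> \<eta>"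
      and T: "finite T" "T \<subseteq> {-1<..1}" "\<And>t. t \<in> {b..c} \<inter> {-1..1} \<Longrightarrow> f t - k T t \<le> \<eta>"
      unfolding P_def by metis
    have "f t - k (S \<union> T) t \<le> \<eta>" if t: "t \<in> {a..c} \<inter> {-1..1}" for t
      using S(3)[of t] T(3)[of t] k_mono[of "S \<union> T" S t] k_mono[of "S \<union> T" T t] S(1) T(1) t
      by (cases "t \<le> b") auto
    then show "P a c" unfolding P_def using S T by (intro exI[of _ "S \<union> T"]) auto
  next
    fix x :: real assume "-1 \<le> x" "x \<le> 1"
    then have x: "x \<in> {-1..1}" by simp
    have fx: "f x = (\<Sum>\<^sub>\<infinity>r\<in>{-1<..1}. xproc f r x)"
      using pjg x pure_jump_part_extend[OF f x] by (simp add: PJG_def)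
    obtain S where S: "finite S" "S \<subseteq> {-1<..1}" and "dist (k S x) (f x) \<le> \<eta> / 2"
      using infsum_finite_approximation[OF summable_xproc[OF f x], of "\<eta>/2"] \<eta>
      unfolding fx k_def by auto
    then have kx: "f x - k S x \<le> \<eta> / 2" unfolding dist_real_def by linarith
    \<comment> \<open>The budget \<open>\<eta> / 2\<close> is divided into one \<open>e\<close> for
      each term of the sum and one for \<open>f\<close> itself.\<close>
    define c e where "c = real (card S) + 1" and "e = \<eta> / (2 * c)"
    have "0 < c" by (simp add: c_def)
    then have "0 < e" "c * e = \<eta> / 2" using \<eta> by (simp_all add: e_def)
    then have e: "0 < e" "(real (card S) + 1) * e = \<eta> / 2" by (simp_all add: c_def)
    obtain \<delta> where \<delta>: "0 < \<delta>" "\<And>u. u \<in> {-1..1} \<Longrightarrow> x \<le> u \<Longrightarrow> u < x + \<delta> \<Longrightarrow> \<bar>f u - f x\<bar> < e"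
      using excursion_near_right[OF f x e(1)] by blast
    have right: "f s - k S s \<le> \<eta>" if s: "s \<in> {-1..1}" "x \<le> s" "s < x + \<delta>" for s
    proof -
      have m: "f x - e \<le> (INF u\<in>{x..s}. f u)"
      proof (rule INF_interval_greatest)
        fix u assume "u \<in> {x..s}"
        then show "f x - e \<le> f u" using \<delta>(2)[of u] s x by auto
      qed (use s in simp)
      have "xproc f r x - e \<le> xproc f r s" if r: "r \<in> S" for r
      proof (cases "r \<le> x")
        case True
        have "r \<in> {-1<..1}" using r S by auto
        then have "xproc f r x \<le> max (f x - left_lim f r) 0"
          "xproc f r s = min (xproc f r x) (max ((INF u\<in>{x..s}. f u) - left_lim f r) 0)"
          using xproc_le[OF f _ x, of r] xproc_min[OF f, of r x s] True s by auto
        then show ?thesis using m e(1) by linarith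
      next
        case False
        then show ?thesis using e(1) xproc_nonneg[of f r s] xproc_before[of x r f] by linarith
      qed
      then have "(\<Sum>r\<in>S. xproc f r x - e) \<le> k S s" unfolding k_def by (rule sum_mono)
      then have "k S x - real (card S) * e \<le> k S s" by (simp add: sum_subtractf k_def)
      then show ?thesis using kx \<delta>(2)[OF s] e(2) by (simp add: algebra_simps)
    qed
    obtain \<gamma> where \<gamma>: "0 < \<gamma>" "\<And>s. s \<in> {-1..1} \<Longrightarrow> x - \<gamma> < s \<Longrightarrow> s < x \<Longrightarrow> f s - k S s \<le> \<eta>"
    proof (cases "x = -1")
      case True
      then show ?thesis using that[of 1] by auto
    next
      case False
      then have x': "x \<in> {-1<..1}" using x by auto
      obtain b where b: "0 < b"
        "\<And>u. u \<in> {-1..1} \<Longrightarrow> x - b < u \<Longrightarrow> u < x \<Longrightarrow> \<bar>f u - left_lim f x\<bar> < \<eta> / 2"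
        using excursion_near_left[OF f x', of "\<eta>/2"] \<eta> by auto
      \<comment> \<open>Times before \<open>x\<close> within distance \<open>c\<close> come after
        every jump time of \<open>S\<close> that precedes \<open>x\<close>.\<close>
      obtain c where c: "0 < c" "\<And>r. r \<in> {r \<in> S. r < x} \<Longrightarrow> c \<le> x - r"
        using finite_set_pos_lower_bound[of "{r \<in> S. r < x}" "\<lambda>r. x - r"] S(1) by auto
      have "f s - k S s \<le> \<eta>" if s: "s \<in> {-1..1}" "x - min b c < s" "s < x" for s
      proof -
        \<comment> \<open>Terms with \<open>r < x\<close> do not increase from \<open>s\<close> to
          \<open>x\<close>, terms with \<open>r > x\<close> vanish at \<open>x\<close>, and the term
          \<open>r = x\<close> contributes exactly its jump.\<close>
        have "xproc f r x \<le> xproc f r s + (if r = x then jump f x else 0)" if r: "r \<in> S" for r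
        proof -
          consider "r < x" | "r = x" | "x < r" by linarith
          then show ?thesis
          proof cases
            case 1
            then have "r \<le> s" using c(2)[of r] r s by auto
            then show ?thesis using xproc_min[OF f, of r s x] s r x S 1 by auto
          qed (use xproc_self[OF f x'] in auto)
        qed
        then have "k S x \<le> (\<Sum>r\<in>S. xproc f r s + (if r = x then jump f x else 0))"
          unfolding k_def by (rule sum_mono)
        also have "\<dots> \<le> k S s + jump f x"
          using S(1) jump_nonneg[OF f x'] by (simp add: sum.distrib k_def)
        finally have "k S x \<le> k S s + jump f x" .
        moreover have "\<bar>f s - left_lim f x\<bar> < \<eta> / 2" using b(2)[of s] s by simp
        ultimately show ?thesis using kx unfolding jump_def by linarith
      qed
      then show ?thesis using that[of "min b c"] b(1) c(1) by auto
    qed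
    have "f s - k S s \<le> \<eta>" if "s \<in> {-1..1}" "x - \<gamma> < s" "s < x + \<delta>" for s
      using right[of s] \<gamma>(2)[of s] that by (cases "s < x") auto
    then have "P a b" if "a \<le> x" "x \<le> b" "b - a < min \<gamma> \<delta>" for a b
      using that S unfolding P_def by (intro exI[of _ S]) auto
    then show "\<exists>d>0. \<forall>a b. a \<le> x \<and> x \<le> b \<and> b - a < d \<longrightarrow> P a b"
      using \<delta>(1) \<gamma>(1) by (intro exI[of _ "min \<gamma> \<delta>"]) auto
  qed simp
  then show ?thesis using that unfolding P_def k_def by auto
qed

section \<open>The coding pseudo-distances\<close>

lemma loop_dist_bounds:
  assumes f: "excursion f" and "r \<in> {-1<..1}" "s \<in> {-1..1}" "t \<in> {-1..1}"
  shows "0 \<le> loop_dist f r (xproc f r s) (xproc f r t)"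
    "loop_dist f r (xproc f r s) (xproc f r t) \<le> \<bar>xproc f r s - xproc f r t\<bar>"
  using xproc_le_jump[OF f, of r s] xproc_le_jump[OF f, of r t] assms
    xproc_nonneg[of f r s] xproc_nonneg[of f r t]
  unfolding loop_dist_def by (auto simp del: xproc_nonneg)

text \<open>On \<open>{0..jump f r}\<close> this is the length of the shorter arc of a circle of
  circumference \<open>jump f r\<close>.\<close>

lemma loop_dist_triangle:
  "x \<in> {0..jump f r} \<Longrightarrow> y \<in> {0..jump f r} \<Longrightarrow> z \<in> {0..jump f r} \<Longrightarrow>
     loop_dist f r x z \<le> loop_dist f r x y + loop_dist f r y z"
  by (auto simp: loop_dist_def min_def abs_if)

lemma
  assumes f: "excursion f" and st: "s \<in> {-1..1}" "t \<in> {-1..1}"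
  shows summable_loop_dist: "(\<lambda>r. loop_dist f r (xproc f r s) (xproc f r t)) summable_on {-1<..1}"
    and summable_xproc_diff: "(\<lambda>r. \<bar>xproc f r s - xproc f r t\<bar>) summable_on {-1<..1}"
    and summable_xproc_min: "(\<lambda>r. min (xproc f r s) (xproc f r t)) summable_on {-1<..1}"
proof -
  have "\<bar>\<bar>xproc f r s - xproc f r t\<bar>\<bar> \<le> xproc f r s + xproc f r t"
    "\<bar>min (xproc f r s) (xproc f r t)\<bar> \<le> xproc f r s + xproc f r t" for r
    using xproc_nonneg[of f r s] xproc_nonneg[of f r t] by linarith+
  then show "(\<lambda>r. \<bar>xproc f r s - xproc f r t\<bar>) summable_on {-1<..1}"
    "(\<lambda>r. min (xproc f r s) (xproc f r t)) summable_on {-1<..1}"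
    by (auto intro!: summable_xproc_dominated[OF f st])
  show "(\<lambda>r. loop_dist f r (xproc f r s) (xproc f r t)) summable_on {-1<..1}"
    using loop_dist_bounds[OF f _ st] xproc_nonneg[of f _ s] xproc_nonneg[of f _ t]
    by (intro summable_xproc_dominated[OF f st]) (smt (verit, best))
qed

lemma dL_extend:
  assumes f: "excursion f" and st: "s \<in> {-1..1}" "t \<in> {-1..1}"
  shows "dL f s t = (\<Sum>\<^sub>\<infinity>r\<in>{-1<..1}. loop_dist f r (xproc f r s) (xproc f r t))"
  unfolding dL_def by (rule infsum_extend_domain)
    (use assms in \<open>simp add: xproc_neg loop_dist_def jump_neg\<close>)

lemma dT_extend:
  assumes f: "excursion f" and st: "s \<in> {-1..1}" "t \<in> {-1..1}"
  shows "dT f s t = f s + f t - 2 * (INF u\<in>{min s t..max s t}. f u)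
     - (\<Sum>\<^sub>\<infinity>r\<in>{-1<..1}. \<bar>xproc f r s - xproc f r t\<bar>)"
  unfolding dT_def by (subst infsum_extend_domain) (use assms in \<open>simp_all add: xproc_neg\<close>)

lemma pseudo_dist_on_dL:
  assumes f: "excursion f"
  shows "pseudo_dist_on {-1..1} (dL f)"
  unfolding pseudo_dist_on_def
proof (intro conjI ballI)
  fix x y z :: real assume xyz: "x \<in> {-1..1}" "y \<in> {-1..1}" "z \<in> {-1..1}"
  let ?l = "\<lambda>s t r. loop_dist f r (xproc f r s) (xproc f r t)"
  have "infsum (?l x z) {-1<..1} \<le> (\<Sum>\<^sub>\<infinity>r\<in>{-1<..1}. ?l x y r + ?l y z r)"
  proof (rule infsum_mono)
    fix r :: real assume r: "r \<in> {-1<..1}"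
    show "?l x z r \<le> ?l x y r + ?l y z r"
      using xproc_le_jump[OF f r] xyz by (intro loop_dist_triangle) auto
  qed (intro summable_loop_dist summable_on_add f xyz)+
  also have "\<dots> = infsum (?l x y) {-1<..1} + infsum (?l y z) {-1<..1}"
    by (intro infsum_add summable_loop_dist f xyz)
  finally show "dL f x z \<le> dL f x y + dL f y z"
    using xyz by (simp add: dL_extend[OF f])
next
  fix x y :: real assume xy: "x \<in> {-1..1}" "y \<in> {-1..1}"
  then show "0 \<le> dL f x y"
    using loop_dist_bounds(1)[OF f] by (auto simp: dL_extend[OF f] intro!: infsum_nonneg)
  show "dL f x y = dL f y x" by (simp add: dL_def loop_dist_def abs_minus_commute)
next
  fix x :: real assume x: "x \<in> {-1..1}"
  then have "loop_dist f r (xproc f r x) (xproc f r x) = 0" if "r \<in> {-1<..1}" for r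
    using loop_dist_bounds[OF f that x x] by simp
  then show "dL f x x = 0" unfolding dL_extend[OF f x x] by (rule infsum_0)
qed

text \<open>The intervals \<open>(left_lim f r, left_lim f r + xproc f r t)\<close>, for \<open>r \<le> t\<close>, are disjoint parts of
  \<open>(0, f t)\<close>. The length of what remains of \<open>(0, m)\<close> outside them is \<open>remaining f t m\<close>; it is
  nondecreasing in \<open>m\<close>, and \<open>dT f\<close> is a tree distance for the heights \<open>remaining f t (f t)\<close>.\<close>

definition remaining :: "(real \<Rightarrow> real) \<Rightarrow> real \<Rightarrow> real \<Rightarrow> real" where
  "remaining f t m = m - (\<Sum>\<^sub>\<infinity>r\<in>{-1<..1}. min (xproc f r t) (max (m - left_lim f r) 0))"

lemma summable_level:
  assumes "excursion f" "t \<in> {-1..1}"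
  shows "(\<lambda>r. min (xproc f r t) (max (m - left_lim f r) 0)) summable_on {-1<..1}"
proof (rule summable_xproc_dominated)
  show "\<bar>min (xproc f r t) (max (m - left_lim f r) 0)\<bar> \<le> xproc f r t + xproc f r t" for r
    using xproc_nonneg[of f r t] by linarith
qed (use assms in auto)

lemma remaining_mono:
  assumes f: "excursion f" and t: "t \<in> {-1..1}" and ab: "a \<le> b"
  shows "remaining f t a \<le> remaining f t b"
proof -
  let ?y = "\<lambda>c r. min (xproc f r t) (max (c - left_lim f r) 0)"
  have "infsum (?y b) {-1<..1} - infsum (?y a) {-1<..1} = (\<Sum>\<^sub>\<infinity>r\<in>{-1<..1}. ?y b r - ?y a r)"
    by (intro infsum_diff[symmetric] summable_level f t)
  also have "\<dots> \<le> b - a"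
  proof (rule infsum_le_finite_sums)
    show "(\<lambda>r. ?y b r - ?y a r) summable_on {-1<..1}"
      by (intro summable_on_diff summable_level f t)
    show "(\<Sum>r\<in>A. ?y b r - ?y a r) \<le> b - a" if "finite A" "A \<subseteq> {-1<..1}" for A
      using sum_xproc_level_le[OF f that t ab] by simp
  qed
  finally show ?thesis by (simp add: remaining_def)
qed

lemma remaining_top:
  assumes f: "excursion f" and t: "t \<in> {-1..1}"
  shows "remaining f t (f t) = f t - (\<Sum>\<^sub>\<infinity>r\<in>{-1<..1}. xproc f r t)"
  unfolding remaining_def using xproc_le[OF f _ t]
  by (auto intro!: infsum_cong min_absorb1)

lemma hull_min_max: "{min s t..max s t} = {min t s..max t (s::real)}"
  by (simp add: min.commute max.commute)

text \<open>Below the infimum between the two times, both see the same pieces: a jump before both is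
  cut in between only at levels from \<open>c\<close> upwards, and a jump in between starts from a
  left limit that is at least \<open>c\<close>, so nothing of it lies below
  \<open>c\<close>.\<close>

lemma xproc_level_cong:
  assumes f: "excursion f" and st: "s \<in> {-1..1}" "t \<in> {-1..1}" and r: "r \<in> {-1<..1}"
    and c: "c \<le> (INF u\<in>{min s t..max s t}. f u)"
  shows "min (xproc f r s) (max (c - left_lim f r) 0) = min (xproc f r t) (max (c - left_lim f r) 0)"
  using st c
proof (induction s t rule: linorder_wlog)
  case (le s t)
  then have c': "c \<le> (INF u\<in>{s..t}. f u)" by simp
  consider "r \<le> s" | "s < r" "r \<le> t" | "t < r" by linarith
  then show ?case
  proof cases
    case 1
    then show ?thesis using xproc_min[OF f, of r s t] le r c' by (auto simp: min_def max_def)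
  next
    case 2
    then have "c \<le> left_lim f r"
      using excursion_INF_le_left_lim[OF f, of s r t] le c' by auto
    then show ?thesis using xproc_nonneg[of f r s] xproc_nonneg[of f r t] by linarith
  qed (use le in auto)
next
  case (sym s t)
  then show ?case by (simp add: hull_min_max)
qed

lemma xproc_level_hull:
  assumes f: "excursion f" and st: "s \<in> {-1..1}" "t \<in> {-1..1}" and r: "r \<in> {-1<..1}"
  shows "min (xproc f r s) (max ((INF u\<in>{min s t..max s t}. f u) - left_lim f r) 0)
    = min (xproc f r s) (xproc f r t)"
  using st
proof (induction s t rule: linorder_wlog)
  case (le s t)
  consider "r \<le> s" | "s < r" "r \<le> t" | "t < r" by linarith
  then show ?case
  proof cases
    case 1
    then show ?thesis using xproc_min[OF f, of r s t] le r by (auto simp: min_def max_def)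
  qed (use le in \<open>auto simp: min_def max_def\<close>)
next
  case (sym s t)
  \<comment> \<open>The truncated term mentions only one of the times; at the level of the infimum
    itself \<open>xproc_level_cong\<close> exchanges it for the other.\<close>
  then show ?case
    using xproc_level_cong[OF f sym(2,3) r order_refl] by (metis hull_min_max min.commute)
qed

lemma remaining_cong:
  assumes f: "excursion f" and st: "s \<in> {-1..1}" "t \<in> {-1..1}"
    and c: "c \<le> (INF u\<in>{min s t..max s t}. f u)"
  shows "remaining f s c = remaining f t c"
  unfolding remaining_def
  by (rule arg_cong2[where f = "(-)"], rule refl, rule infsum_cong, rule xproc_level_cong[OF f st _ c])

text \<open>An absolute difference is the sum minus twice the minimum, and by
  \<open>xproc_level_hull\<close> that minimum is the truncation at the infimum. The result is the
  usual tree distance: two heights minus twice the height of the branch point, which by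
  \<open>remaining_cong\<close> can be read from either side.\<close>

lemma dT_eq_remaining:
  assumes f: "excursion f" and st: "s \<in> {-1..1}" "t \<in> {-1..1}"
  shows "dT f s t = remaining f s (f s) + remaining f t (f t)
    - 2 * remaining f s (INF u\<in>{min s t..max s t}. f u)"
proof -
  let ?min = "\<lambda>r. min (xproc f r s) (xproc f r t)"
  have "\<bar>xproc f r s - xproc f r t\<bar> = (xproc f r s + xproc f r t) - 2 * ?min r" for r
    by (simp add: min_def)
  then have "(\<Sum>\<^sub>\<infinity>r\<in>{-1<..1}. \<bar>xproc f r s - xproc f r t\<bar>)
      = (\<Sum>\<^sub>\<infinity>r\<in>{-1<..1}. (xproc f r s + xproc f r t) - 2 * ?min r)" by simp
  also have "\<dots> = (\<Sum>\<^sub>\<infinity>r\<in>{-1<..1}. xproc f r s) + (\<Sum>\<^sub>\<infinity>r\<in>{-1<..1}. xproc f r t)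
      - 2 * (\<Sum>\<^sub>\<infinity>r\<in>{-1<..1}. ?min r)"
    using summable_xproc[OF f st(1)] summable_xproc[OF f st(2)] summable_xproc_min[OF f st]
    by (subst infsum_diff) (auto intro!: summable_on_add summable_on_cmult_right simp: infsum_add infsum_cmult_right)
  finally have diff: "(\<Sum>\<^sub>\<infinity>r\<in>{-1<..1}. \<bar>xproc f r s - xproc f r t\<bar>)
      = (\<Sum>\<^sub>\<infinity>r\<in>{-1<..1}. xproc f r s) + (\<Sum>\<^sub>\<infinity>r\<in>{-1<..1}. xproc f r t)
      - 2 * (\<Sum>\<^sub>\<infinity>r\<in>{-1<..1}. ?min r)" .
  have "remaining f s (INF u\<in>{min s t..max s t}. f u)
      = (INF u\<in>{min s t..max s t}. f u) - (\<Sum>\<^sub>\<infinity>r\<in>{-1<..1}. ?min r)"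
    unfolding remaining_def
    by (rule arg_cong2[where f = "(-)"], rule refl, rule infsum_cong, rule xproc_level_hull[OF f st])
  with diff show ?thesis
    unfolding dT_extend[OF f st] remaining_top[OF f st(1)] remaining_top[OF f st(2)] by linarith
qed

lemma hull_INF_le:
  assumes f: "excursion f" and st: "s \<in> {-1..1}" "t \<in> {-1..1}"
  shows "(INF u\<in>{min s t..max s t}. f u) \<le> f s" "(INF u\<in>{min s t..max s t}. f u) \<le> f t"
  using st by (auto intro!: excursion_INF_lower[OF f])

lemma pseudo_dist_on_dT:
  assumes f: "excursion f"
  shows "pseudo_dist_on {-1..1} (dT f)"
  unfolding pseudo_dist_on_def
proof (intro conjI ballI)
  fix x :: real assume x: "x \<in> {-1..1}"
  show "dT f x x = 0" by (simp add: dT_def)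
next
  fix x y :: real assume xy: "x \<in> {-1..1}" "y \<in> {-1..1}"
  let ?m = "INF u\<in>{min x y..max x y}. f u"
  have "remaining f x ?m \<le> remaining f x (f x)" "remaining f y ?m \<le> remaining f y (f y)"
    by (intro remaining_mono[OF f] xy hull_INF_le[OF f])+
  then show "0 \<le> dT f x y"
    using remaining_cong[OF f xy order_refl] by (simp add: dT_eq_remaining[OF f xy])
  show "dT f x y = dT f y x"
    by (simp add: dT_def abs_minus_commute min.commute max.commute)
next
  fix x y z :: real assume xyz: "x \<in> {-1..1}" "y \<in> {-1..1}" "z \<in> {-1..1}"
  let ?m = "\<lambda>s t. INF u\<in>{min s t..max s t}. f u"
  let ?h = "remaining f"
  \<comment> \<open>The interval between \<open>x\<close> and \<open>z\<close> is covered by those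
    between \<open>x\<close>, \<open>y\<close> and between \<open>y\<close>,
    \<open>z\<close>.\<close>
  have m: "min (?m x y) (?m y z) \<le> ?m x z"
  proof (rule INF_interval_greatest)
    fix u assume "u \<in> {min x z..max x z}"
    then have "u \<in> {min x y..max x y} \<or> u \<in> {min y z..max y z}" by (auto simp: min_def max_def split: if_splits)
    then have "?m x y \<le> f u \<or> ?m y z \<le> f u"
      using excursion_INF_lower[OF f, of "min x y" "max x y" u]
        excursion_INF_lower[OF f, of "min y z" "max y z" u] xyz by auto
    then show "min (?m x y) (?m y z) \<le> f u" by auto
  qed simp
  have "?h x (?m x y) = ?h y (?m x y)" "?h x (min (?m x y) (?m y z)) = ?h y (min (?m x y) (?m y z))"
    by (intro remaining_cong[OF f] xyz; simp)+
  moreover have "?h x (min (?m x y) (?m y z)) \<le> ?h x (?m x z)"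
    by (intro remaining_mono[OF f] xyz m)
  moreover have "?h y (max (?m x y) (?m y z)) \<le> ?h y (f y)"
    by (intro remaining_mono[OF f] xyz max.boundedI hull_INF_le[OF f])
  \<comment> \<open>Only the sum of the two branch heights seen from \<open>y\<close> matters: the
    lower one is at most the branch height of \<open>x\<close> and \<open>z\<close>, the higher one
    at most the height of \<open>y\<close>.\<close>
  moreover have "?h y (?m x y) + ?h y (?m y z)
      = ?h y (min (?m x y) (?m y z)) + ?h y (max (?m x y) (?m y z))"
    by (simp add: min_def max_def)
  ultimately show "dT f x z \<le> dT f x y + dT f y z"
    unfolding dT_eq_remaining[OF f xyz(1,2)] dT_eq_remaining[OF f xyz(2,3)]
      dT_eq_remaining[OF f xyz(1,3)] by linarith
qed

text \<open>At a jump time \<open>t\<close> the loop distance identifies \<open>0\<close> with \<open>jump f t\<close>; this is what makes \<open>dL f\<close>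
  continuous although \<open>f\<close> is not.\<close>

lemma dT_plus_dL_le:
  assumes f: "excursion f" and st: "s \<in> {-1..1}" "t \<in> {-1..1}"
  shows "dT f s t + dL f s t \<le> f s + f t - 2 * (INF u\<in>{min s t..max s t}. f u)
    - (if s < t then jump f t else 0)"
proof -
  let ?l = "\<lambda>r. loop_dist f r (xproc f r s) (xproc f r t)" and ?a = "\<lambda>r. \<bar>xproc f r s - xproc f r t\<bar>"
  \<comment> \<open>The sum of the \<open>?a\<close> enters \<open>dT\<close> with a minus sign, so
    it cancels against this bound.\<close>
  have "dL f s t \<le> infsum ?a {-1<..1} - (if s < t then jump f t else 0)"
  proof (cases "s < t")
    case False
    then show ?thesis
      using infsum_mono[OF summable_loop_dist[OF f st] summable_xproc_diff[OF f st]]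
        loop_dist_bounds(2)[OF f _ st] by (simp add: dL_extend[OF f st])
  next
    case True
    then have t: "t \<in> {-1<..1}" using st by auto
    have "?l t = 0" "?a t = jump f t"
      using True xproc_self[OF f t] jump_nonneg[OF f t] by (auto simp: loop_dist_def)
    moreover have "infsum ?l ({-1<..1} - {t}) \<le> infsum ?a ({-1<..1} - {t})"
      using summable_loop_dist[OF f st] summable_xproc_diff[OF f st] loop_dist_bounds(2)[OF f _ st]
      by (intro infsum_mono) (auto intro: summable_on_subset)
    moreover have "infsum g {-1<..1} = g t + infsum g ({-1<..1} - {t})"
      if "g summable_on {-1<..1}" for g :: "real \<Rightarrow> real"
    proof -
      have "infsum g (insert t ({-1<..1} - {t})) = g t + infsum g ({-1<..1} - {t})"
        using that by (intro infsum_insert) (auto intro: summable_on_subset)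
      then show ?thesis using t by (simp add: insert_absorb)
    qed
    ultimately show ?thesis
      using True summable_loop_dist[OF f st] summable_xproc_diff[OF f st]
      by (simp add: dL_extend[OF f st])
  qed
  then show ?thesis by (simp add: dT_extend[OF f st])
qed

section \<open>Continuity of the coding pseudo-distances\<close>

text \<open>Both distances are nonnegative, so a bound on their sum suffices. To the right of
  \<open>t\<close> the values of \<open>f\<close> stay near \<open>f t\<close>; to the left, the
  jump subtracted in \<open>dT_plus_dL_le\<close> turns \<open>f t\<close> into
  \<open>left_lim f t\<close>, which the earlier values approach.\<close>

lemma dT_dL_local:
  assumes f: "excursion f" and t: "t \<in> {-1..1}" and e: "0 < e"
  shows "\<exists>\<delta>>0. \<forall>s\<in>{-1..1}. dist s t < \<delta> \<longrightarrow> dT f s t < e \<and> dL f s t < e"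
proof -
  have nonneg: "0 \<le> dT f s t" "0 \<le> dL f s t" if "s \<in> {-1..1}" for s
    using pseudo_dist_onD(2)[OF pseudo_dist_on_dT[OF f] that t]
      pseudo_dist_onD(2)[OF pseudo_dist_on_dL[OF f] that t] by auto
  obtain a where a: "0 < a" "\<And>u. u \<in> {-1..1} \<Longrightarrow> t \<le> u \<Longrightarrow> u < t + a \<Longrightarrow> \<bar>f u - f t\<bar> < e / 4"
    using excursion_near_right[OF f t, of "e/4"] e by auto
  have right: "dT f s t + dL f s t < e" if s: "s \<in> {-1..1}" "t \<le> s" "s < t + a" for s
  proof -
    have "f t - e / 4 \<le> (INF u\<in>{min s t..max s t}. f u)"
    proof (rule INF_interval_greatest)
      fix u assume "u \<in> {min s t..max s t}"
      then show "f t - e / 4 \<le> f u" using a(2)[of u] s t by (auto simp: min_def max_def abs_if split: if_splits)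
    qed simp
    then show ?thesis using dT_plus_dL_le[OF f s(1) t] a(2)[OF s] s e by (simp add: abs_if split: if_splits)
  qed
  obtain b where b: "0 < b" "\<And>s. s \<in> {-1..1} \<Longrightarrow> t - b < s \<Longrightarrow> s < t \<Longrightarrow> dT f s t + dL f s t < e"
  proof (cases "t = -1")
    case True
    then show ?thesis using that[of 1] by auto
  next
    case False
    then have t': "t \<in> {-1<..1}" using t by auto
    obtain b where b: "0 < b"
      "\<And>u. u \<in> {-1..1} \<Longrightarrow> t - b < u \<Longrightarrow> u < t \<Longrightarrow> \<bar>f u - left_lim f t\<bar> < e / 4"
      using excursion_near_left[OF f t', of "e/4"] e by auto
    have "dT f s t + dL f s t < e" if s: "s \<in> {-1..1}" "t - b < s" "s < t" for s
    proof -
      have "left_lim f t - e / 4 \<le> (INF u\<in>{min s t..max s t}. f u)"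
      proof (rule INF_interval_greatest)
        fix u assume u: "u \<in> {min s t..max s t}"
        show "left_lim f t - e / 4 \<le> f u"
          using b(2)[of u] left_lim_le[OF f t'] u s t e
          by (cases "u = t") (auto simp: min_def max_def abs_if split: if_splits)
      qed simp
      then show ?thesis using dT_plus_dL_le[OF f s(1) t] b(2)[OF s] s e
        by (simp add: abs_if jump_def split: if_splits)
    qed
    then show ?thesis using that b by blast
  qed
  have "dT f s t < e \<and> dL f s t < e" if s: "s \<in> {-1..1}" "dist s t < min a b" for s
    using right[of s] b(2)[of s] nonneg[of s] s by (cases "s < t") (auto simp: dist_real_def)
  then show ?thesis using a(1) b(1) by (intro exI[of _ "min a b"]) auto
qed

lemma continuous_on_dL: "excursion f \<Longrightarrow> continuous_on ({-1..1} \<times> {-1..1}) (\<lambda>(s, t). dL f s t)"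
  using dT_dL_local[of f] by (intro pseudo_dist_on_continuous pseudo_dist_on_dL) meson+

lemma continuous_on_dT: "excursion f \<Longrightarrow> continuous_on ({-1..1} \<times> {-1..1}) (\<lambda>(s, t). dT f s t)"
  using dT_dL_local[of f] by (intro pseudo_dist_on_continuous pseudo_dist_on_dT) meson+

section \<open>Time changes\<close>

lemma
  assumes "\<phi> \<in> time_changes"
  shows time_change_in: "r \<in> {-1..1} \<Longrightarrow> \<phi> r \<in> {-1..1}"
    and time_change_less: "r \<in> {-1..1} \<Longrightarrow> s \<in> {-1..1} \<Longrightarrow> \<phi> r < \<phi> s \<longleftrightarrow> r < s"
    and time_change_le: "r \<in> {-1..1} \<Longrightarrow> s \<in> {-1..1} \<Longrightarrow> \<phi> r \<le> \<phi> s \<longleftrightarrow> r \<le> s"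
    and time_change_surj: "y \<in> {-1..1} \<Longrightarrow> \<exists>x\<in>{-1..1}. \<phi> x = y"
proof -
  have mono: "strict_mono_on {-1..1} \<phi>" and bij: "bij_betw \<phi> {-1..1} {-1..1}"
    using assms by (auto simp: time_changes_def)
  show "r \<in> {-1..1} \<Longrightarrow> \<phi> r \<in> {-1..1}" using bij bij_betw_apply by fastforce
  show "r \<in> {-1..1} \<Longrightarrow> s \<in> {-1..1} \<Longrightarrow> \<phi> r < \<phi> s \<longleftrightarrow> r < s"
    using strict_mono_on_less[OF mono] by blast
  show "r \<in> {-1..1} \<Longrightarrow> s \<in> {-1..1} \<Longrightarrow> \<phi> r \<le> \<phi> s \<longleftrightarrow> r \<le> s"
    using strict_mono_on_less_eq[OF mono] by blast
  show "y \<in> {-1..1} \<Longrightarrow> \<exists>x\<in>{-1..1}. \<phi> x = y" using bij unfolding bij_betw_def by (metis image_iff)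
qed

lemma time_change_minus_one:
  assumes "\<phi> \<in> time_changes" shows "\<phi> (-1) = -1"
proof -
  obtain x where "x \<in> {-1..1}" "\<phi> x = -1" using time_change_surj[OF assms, of "-1"] by auto
  then show ?thesis using time_change_le[OF assms, of "-1" x] time_change_in[OF assms, of "-1"] by auto
qed

lemma time_change_in':
  assumes "\<phi> \<in> time_changes" "r \<in> {-1<..1}" shows "\<phi> r \<in> {-1<..1}"
  using time_change_less[OF assms(1), of "-1" r] time_change_in[OF assms(1), of r]
    time_change_minus_one[OF assms(1)] assms(2) by auto

text \<open>The end point -1 is fixed, so the index set of the extended sums is mapped onto itself;
  this is what permits reindexing them.\<close>

lemma time_change_bij:
  assumes "\<phi> \<in> time_changes" shows "bij_betw \<phi> {-1<..1} {-1<..1}"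
proof -
  have "bij_betw \<phi> ({-1..1} - {-1}) ({-1..1} - {\<phi> (-1)})"
    using assms time_change_in[OF assms, of "-1"]
    by (intro bij_betw_DiffI) (auto simp: time_changes_def)
  moreover have "{-1..1} - {-1} = {-1<..1::real}" by auto
  ultimately show ?thesis by (simp add: time_change_minus_one[OF assms])
qed

text \<open>A monotone bijection has no jumps: \<open>max b (-1)\<close> has a preimage
  \<open>u0\<close>, and the times between \<open>u0\<close> and \<open>r\<close> are sent between
  \<open>b\<close> and \<open>\<phi> r\<close>.\<close>

lemma filterlim_time_change_at_left:
  assumes \<phi>: "\<phi> \<in> time_changes" and r: "r \<in> {-1<..1}"
  shows "filterlim \<phi> (at_left (\<phi> r)) (at_left r)"
  unfolding filterlim_iff
proof (intro allI impI)
  fix P assume "eventually P (at_left (\<phi> r))"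
  then obtain b where b: "b < \<phi> r" "\<And>y. b < y \<Longrightarrow> y < \<phi> r \<Longrightarrow> P y"
    unfolding eventually_at_left_field by blast
  have \<phi>r: "\<phi> r \<in> {-1<..1}" by (rule time_change_in'[OF \<phi> r])
  have "max b (-1) \<in> {-1..1}" using b \<phi>r by auto
  then obtain u0 where u0: "u0 \<in> {-1..1}" "\<phi> u0 = max b (-1)"
    using time_change_surj[OF \<phi>] by blast
  have "u0 < r" using time_change_less[OF \<phi> u0(1), of r] u0 b \<phi>r r by auto
  then have "\<forall>\<^sub>F u in at_left r. u \<in> {u0<..<r}" by (rule eventually_at_left_in_domain)
  then show "\<forall>\<^sub>F u in at_left r. P (\<phi> u)"
  proof eventually_elim
    case (elim u)
    then have "\<phi> u0 < \<phi> u" "\<phi> u < \<phi> r"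
      using time_change_less[OF \<phi>, of u0 u] time_change_less[OF \<phi>, of u r] u0 r by auto
    then show ?case using b u0 by auto
  qed
qed

lemma skorokhod_dist_lessD:
  assumes g: "excursion g" and f: "excursion f" and less: "skorokhod_dist g f < e"
  obtains \<phi> where "\<phi> \<in> time_changes" "\<And>t. t \<in> {-1..1} \<Longrightarrow> \<bar>\<phi> t - t\<bar> < e"
    "\<And>t. t \<in> {-1..1} \<Longrightarrow> \<bar>g t - f (\<phi> t)\<bar> < e"
proof -
  \<comment> \<open>The infimum is thereby taken over a nonempty set, as \<open>cInf_lessD\<close>
    requires.\<close>
  have "id \<in> time_changes" by (auto simp: time_changes_def strict_mono_on_def)
  then obtain \<phi> where \<phi>: "\<phi> \<in> time_changes"
    and m: "max (SUP t\<in>{-1..1}. \<bar>\<phi> t - t\<bar>) (SUP t\<in>{-1..1}. \<bar>g t - f (\<phi> t)\<bar>) < e"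
    using cInf_lessD[OF _ less[unfolded skorokhod_dist_def]] by auto
  \<comment> \<open>A real supremum is known to dominate its terms only when they are bounded above;
    boundedness of excursions provides this.\<close>
  obtain B C where BC: "\<And>t. t \<in> {-1..1} \<Longrightarrow> f t \<le> B" "\<And>t. t \<in> {-1..1} \<Longrightarrow> g t \<le> C"
    using excursion_bounded[OF f] excursion_bounded[OF g] by metis
  have bd1: "\<bar>\<phi> t - t\<bar> \<le> 2" if "t \<in> {-1..1}" for t
    using time_change_in[OF \<phi> that] that by auto
  have bd2: "\<bar>g t - f (\<phi> t)\<bar> \<le> B + C" if "t \<in> {-1..1}" for t
    using BC(1)[OF time_change_in[OF \<phi> that]] BC(2)[OF that] excursion_nonneg[OF g that]
      excursion_nonneg[OF f time_change_in[OF \<phi> that]] by auto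
  have "\<bar>\<phi> t - t\<bar> < e" "\<bar>g t - f (\<phi> t)\<bar> < e" if t: "t \<in> {-1..1}" for t
  proof -
    have "\<bar>\<phi> t - t\<bar> \<le> (SUP t\<in>{-1..1}. \<bar>\<phi> t - t\<bar>)"
      by (rule cSUP_upper[OF t]) (auto intro!: bdd_aboveI2[of _ _ 2] bd1)
    moreover have "\<bar>g t - f (\<phi> t)\<bar> \<le> (SUP t\<in>{-1..1}. \<bar>g t - f (\<phi> t)\<bar>)"
      by (rule cSUP_upper[OF t]) (auto intro!: bdd_aboveI2[of _ _ "B + C"] bd2)
    ultimately show "\<bar>\<phi> t - t\<bar> < e" "\<bar>g t - f (\<phi> t)\<bar> < e" using m by auto
  qed
  then show ?thesis using that \<phi> by blast
qed

section \<open>Comparison of two excursions through a time change\<close>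

text \<open>All estimates compare \<open>g\<close> at time \<open>t\<close> with \<open>f\<close> at
  time \<open>\<phi> t\<close>. How far \<open>\<phi>\<close> moves times is treated separately, by
  uniform continuity of the limit distances.\<close>

locale time_changed =
  fixes g f \<phi> :: "real \<Rightarrow> real" and e :: real
  assumes g: "excursion g" and f: "excursion f" and \<phi>: "\<phi> \<in> time_changes"
    and near: "\<And>t. t \<in> {-1..1} \<Longrightarrow> \<bar>g t - f (\<phi> t)\<bar> \<le> e"
begin

lemma e_nonneg: "0 \<le> e"
  using near[of 0] by simp

lemma left_lim_near:
  assumes r: "r \<in> {-1<..1}"
  shows "\<bar>left_lim g r - left_lim f (\<phi> r)\<bar> \<le> e"
proof (rule tendsto_upperbound)
  have "((\<lambda>u. f (\<phi> u)) \<longlongrightarrow> left_lim f (\<phi> r)) (at_left r)"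
    using excursion_left[OF f time_change_in'[OF \<phi> r]] filterlim_time_change_at_left[OF \<phi> r]
    by (rule filterlim_compose)
  then show "((\<lambda>u. \<bar>g u - f (\<phi> u)\<bar>) \<longlongrightarrow> \<bar>left_lim g r - left_lim f (\<phi> r)\<bar>) (at_left r)"
    using excursion_left[OF g r] by (intro tendsto_intros)
  show "\<forall>\<^sub>F u in at_left r. \<bar>g u - f (\<phi> u)\<bar> \<le> e"
    using eventually_at_left_in_domain[of "-1" r] r by (auto elim!: eventually_mono intro!: near)
qed simp

lemma jump_near:
  assumes r: "r \<in> {-1<..1}"
  shows "\<bar>jump g r - jump f (\<phi> r)\<bar> \<le> 2 * e"
  using left_lim_near[OF r] near[of r] r by (auto simp: jump_def abs_le_iff)

text \<open>\<open>\<phi>\<close> maps \<open>{s..t}\<close> onto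
  \<open>{\<phi> s..\<phi> t}\<close>, so each infimum bounds the other up to
  \<open>e\<close>.\<close>

lemma INF_near:
  assumes st: "s \<in> {-1..1}" "t \<in> {-1..1}" "s \<le> t"
  shows "\<bar>(INF u\<in>{s..t}. g u) - (INF u\<in>{\<phi> s..\<phi> t}. f u)\<bar> \<le> e"
proof -
  have \<phi>st: "\<phi> s \<in> {-1..1}" "\<phi> t \<in> {-1..1}" "\<phi> s \<le> \<phi> t"
    using time_change_in[OF \<phi>] time_change_le[OF \<phi>] st by auto
  have "(INF u\<in>{\<phi> s..\<phi> t}. f u) - e \<le> (INF u\<in>{s..t}. g u)"
  proof (rule INF_interval_greatest)
    fix u assume u: "u \<in> {s..t}"
    then have "\<phi> u \<in> {\<phi> s..\<phi> t}" using time_change_le[OF \<phi>, of s u] time_change_le[OF \<phi>, of u t] st by auto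
    then show "(INF u\<in>{\<phi> s..\<phi> t}. f u) - e \<le> g u"
      using excursion_INF_lower[OF f, of "\<phi> s" "\<phi> t" "\<phi> u"] \<phi>st near[of u] u st by auto
  qed (use st in simp)
  moreover have "(INF u\<in>{s..t}. g u) - e \<le> (INF u\<in>{\<phi> s..\<phi> t}. f u)"
  proof (rule INF_interval_greatest)
    fix v assume v: "v \<in> {\<phi> s..\<phi> t}"
    then obtain u where u: "u \<in> {-1..1}" "\<phi> u = v" using time_change_surj[OF \<phi>, of v] \<phi>st by auto
    then have "u \<in> {s..t}" using time_change_le[OF \<phi>, of s u] time_change_le[OF \<phi>, of u t] st v by auto
    then show "(INF u\<in>{s..t}. g u) - e \<le> f v"
      using excursion_INF_lower[OF g, of s t u] near[of u] u st by auto
  qed (use \<phi>st in simp)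
  ultimately show ?thesis by (simp add: abs_le_iff)
qed

text \<open>One \<open>e\<close> comes from the infimum and one from the left limit; for
  \<open>t < r\<close> monotonicity of \<open>\<phi>\<close> makes both terms 0.\<close>

lemma xproc_near:
  assumes r: "r \<in> {-1<..1}" and t: "t \<in> {-1..1}"
  shows "\<bar>xproc g r t - xproc f (\<phi> r) (\<phi> t)\<bar> \<le> 2 * e"
proof (cases "r \<le> t")
  case True
  then have "\<phi> r \<le> \<phi> t" using time_change_le[OF \<phi>, of r t] r t by auto
  then show ?thesis
    using INF_near[of r t] left_lim_near[OF r] True r t unfolding xproc_def by auto
next
  case False
  then have "\<phi> t < \<phi> r" using time_change_less[OF \<phi>, of t r] r t by auto
  then show ?thesis using False e_nonneg by simp
qed

text \<open>Reindexing along \<open>\<phi>\<close> lets the sums for \<open>g\<close> and for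
  \<open>f\<close> run over the same index, ready for termwise comparison.\<close>

lemma
  fixes s t :: real
  defines "l \<equiv> \<lambda>r. loop_dist f r (xproc f r (\<phi> s)) (xproc f r (\<phi> t))"
    and "a \<equiv> \<lambda>r. \<bar>xproc f r (\<phi> s) - xproc f r (\<phi> t)\<bar>"
  assumes st: "s \<in> {-1..1}" "t \<in> {-1..1}"
  shows summable_time_changed: "(\<lambda>r. l (\<phi> r)) summable_on {-1<..1}" "(\<lambda>r. a (\<phi> r)) summable_on {-1<..1}"
    and infsum_time_changed: "infsum (\<lambda>r. l (\<phi> r)) {-1<..1} = infsum l {-1<..1}"
      "infsum (\<lambda>r. a (\<phi> r)) {-1<..1} = infsum a {-1<..1}"
proof -
  have \<phi>st: "\<phi> s \<in> {-1..1}" "\<phi> t \<in> {-1..1}" using time_change_in[OF \<phi>] st by auto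
  have "l summable_on {-1<..1}" "a summable_on {-1<..1}"
    unfolding l_def a_def using summable_loop_dist[OF f \<phi>st] summable_xproc_diff[OF f \<phi>st] .
  then show "(\<lambda>r. l (\<phi> r)) summable_on {-1<..1}" "(\<lambda>r. a (\<phi> r)) summable_on {-1<..1}"
    using summable_on_reindex_bij_betw[OF time_change_bij[OF \<phi>], of l]
      summable_on_reindex_bij_betw[OF time_change_bij[OF \<phi>], of a] by simp_all
  show "infsum (\<lambda>r. l (\<phi> r)) {-1<..1} = infsum l {-1<..1}"
    "infsum (\<lambda>r. a (\<phi> r)) {-1<..1} = infsum a {-1<..1}"
    by (rule infsum_reindex_bij_betw[OF time_change_bij[OF \<phi>]])+
qed

end

text \<open>\<open>S\<close> consists of times on the clock of \<open>g\<close>, and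
  \<open>f\<close> is read through \<open>\<phi>\<close>. The tails are bounded uniformly in
  \<open>t\<close> and through finite sums, the form that
  \<open>infsum_diff_le_of_finite_sums\<close> takes.\<close>

locale controlled_jumps = time_changed +
  fixes S :: "real set" and \<eta> :: real
  assumes S: "finite S"
    and tail_g: "\<And>A t. finite A \<Longrightarrow> A \<subseteq> {-1<..1} - S \<Longrightarrow> t \<in> {-1..1} \<Longrightarrow> (\<Sum>r\<in>A. xproc g r t) \<le> \<eta>"
    and tail_f: "\<And>A t. finite A \<Longrightarrow> A \<subseteq> {-1<..1} - S \<Longrightarrow> t \<in> {-1..1} \<Longrightarrow>
      (\<Sum>r\<in>A. xproc f (\<phi> r) (\<phi> t)) \<le> \<eta>"
begin

lemma tail_sum:
  assumes "finite A" "A \<subseteq> {-1<..1} - S" "s \<in> {-1..1}" "t \<in> {-1..1}"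
  shows "(\<Sum>r\<in>A. xproc g r s + xproc g r t + xproc f (\<phi> r) (\<phi> s) + xproc f (\<phi> r) (\<phi> t)) \<le> 4 * \<eta>"
  using tail_g[OF assms(1,2,3)] tail_g[OF assms(1,2,4)] tail_f[OF assms(1,2,3)] tail_f[OF assms(1,2,4)]
  by (simp add: sum.distrib)

lemma dL_near:
  assumes st: "s \<in> {-1..1}" "t \<in> {-1..1}"
  shows "\<bar>dL g s t - dL f (\<phi> s) (\<phi> t)\<bar> \<le> real (card S) * (6 * e) + 4 * \<eta>"
proof -
  let ?a = "\<lambda>r. loop_dist g r (xproc g r s) (xproc g r t)"
  let ?b = "\<lambda>r. loop_dist f (\<phi> r) (xproc f (\<phi> r) (\<phi> s)) (xproc f (\<phi> r) (\<phi> t))"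
  have \<phi>st: "\<phi> s \<in> {-1..1}" "\<phi> t \<in> {-1..1}" using time_change_in[OF \<phi>] st by auto
  have "\<bar>infsum ?a {-1<..1} - infsum ?b {-1<..1}\<bar> \<le> real (card S) * (6 * e) + 4 * \<eta>"
  proof (rule infsum_diff_le_of_finite_sums[OF _ _ S _ _ _ tail_sum[OF _ _ st]])
    fix r :: real assume "r \<in> {-1<..1} \<inter> S"
    then have r: "r \<in> {-1<..1}" by simp
    \<comment> \<open>Each of the two processes contributes \<open>2 * e\<close>, and so does the
      circumference of the loop.\<close>
    show "\<bar>?a r - ?b r\<bar> \<le> 6 * e"
      using xproc_near[OF r st(1)] xproc_near[OF r st(2)] jump_near[OF r]
      unfolding loop_dist_def by linarith
  next
    fix r :: real assume "r \<in> {-1<..1} - S"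
    then have r: "r \<in> {-1<..1}" "\<phi> r \<in> {-1<..1}" using time_change_in'[OF \<phi>] by auto
    show "\<bar>?a r - ?b r\<bar> \<le> xproc g r s + xproc g r t + xproc f (\<phi> r) (\<phi> s) + xproc f (\<phi> r) (\<phi> t)"
      using loop_dist_bounds[OF g r(1) st] loop_dist_bounds[OF f r(2) \<phi>st]
        xproc_nonneg[of g r s] xproc_nonneg[of g r t] xproc_nonneg[of f "\<phi> r" "\<phi> s"]
        xproc_nonneg[of f "\<phi> r" "\<phi> t"] by linarith
  qed (use e_nonneg summable_loop_dist[OF g st] summable_time_changed[OF st] in auto)
  then show ?thesis
    by (simp add: dL_extend[OF g st] dL_extend[OF f \<phi>st] infsum_time_changed[OF st])
qed

lemma dT_near:
  assumes st: "s \<in> {-1..1}" "t \<in> {-1..1}"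
  shows "\<bar>dT g s t - dT f (\<phi> s) (\<phi> t)\<bar> \<le> 4 * e + (real (card S) * (4 * e) + 4 * \<eta>)"
proof -
  let ?a = "\<lambda>r. \<bar>xproc g r s - xproc g r t\<bar>"
  let ?b = "\<lambda>r. \<bar>xproc f (\<phi> r) (\<phi> s) - xproc f (\<phi> r) (\<phi> t)\<bar>"
  have \<phi>st: "\<phi> s \<in> {-1..1}" "\<phi> t \<in> {-1..1}" using time_change_in[OF \<phi>] st by auto
  have "\<bar>infsum ?a {-1<..1} - infsum ?b {-1<..1}\<bar> \<le> real (card S) * (4 * e) + 4 * \<eta>"
  proof (rule infsum_diff_le_of_finite_sums[OF _ _ S _ _ _ tail_sum[OF _ _ st]])
    fix r :: real assume "r \<in> {-1<..1} \<inter> S"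
    then have r: "r \<in> {-1<..1}" by simp
    show "\<bar>?a r - ?b r\<bar> \<le> 4 * e"
      using xproc_near[OF r st(1)] xproc_near[OF r st(2)] by linarith
  next
    fix r :: real
    show "\<bar>?a r - ?b r\<bar> \<le> xproc g r s + xproc g r t + xproc f (\<phi> r) (\<phi> s) + xproc f (\<phi> r) (\<phi> t)"
      using xproc_nonneg[of g r s] xproc_nonneg[of g r t] xproc_nonneg[of f "\<phi> r" "\<phi> s"]
        xproc_nonneg[of f "\<phi> r" "\<phi> t"] by linarith
  qed (use e_nonneg summable_xproc_diff[OF g st] summable_time_changed[OF st] in auto)
  moreover have "min (\<phi> s) (\<phi> t) = \<phi> (min s t)" "max (\<phi> s) (\<phi> t) = \<phi> (max s t)"
    using time_change_le[OF \<phi>, of s t] time_change_le[OF \<phi>, of t s] st by (auto simp: min_def max_def)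
  moreover have "\<bar>(INF u\<in>{min s t..max s t}. g u) - (INF u\<in>{\<phi> (min s t)..\<phi> (max s t)}. f u)\<bar> \<le> e"
    using st by (intro INF_near) (auto simp: min_def max_def)
  \<comment> \<open>The term \<open>4 * e\<close> takes one \<open>e\<close> for each of the two
    values and two for the doubled infimum.\<close>
  moreover have "\<bar>(g s + g t - 2 * m - i) - (g' + h' - 2 * m' - j)\<bar> \<le> 4 * e + K"
    if "\<bar>g s - g'\<bar> \<le> e" "\<bar>g t - h'\<bar> \<le> e" "\<bar>m - m'\<bar> \<le> e" "\<bar>i - j\<bar> \<le> K" for g' h' m m' i j K
    using that by linarith
  ultimately show ?thesis
    using near[OF st(1)] near[OF st(2)]
    by (simp only: dT_extend[OF g st] dT_extend[OF f \<phi>st] infsum_time_changed(2)[OF st])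
qed

end

section \<open>Finite sets that control the sums over jumps\<close>

text \<open>Outside the jump times of \<open>g\<close> and the times that \<open>\<phi>\<close>
  sends to jump times of \<open>f\<close>, all terms vanish; hence the tail bound 0.\<close>

lemma controlled_jumps_finite:
  assumes "time_changed g f \<phi> e" and J: "finite (jump_times g)" "finite (jump_times f)"
  obtains S where "controlled_jumps g f \<phi> e S 0" "card S \<le> card (jump_times g) + card (jump_times f)"
proof -
  interpret time_changed g f \<phi> e by fact
  define T where "T = {r \<in> {-1<..1}. \<phi> r \<in> jump_times f}"
  have inj: "inj_on \<phi> T"
    using time_change_bij[OF \<phi>] by (auto simp: T_def bij_betw_def intro: inj_on_subset)
  have sub: "\<phi> ` T \<subseteq> jump_times f" by (auto simp: T_def)
  have T: "finite T" "card T \<le> card (jump_times f)"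
    using inj_on_finite[OF inj sub J(2)] card_inj_on_le[OF inj sub J(2)] by auto
  have zero: "xproc g r t = 0" "xproc f (\<phi> r) (\<phi> t) = 0"
    if "r \<in> {-1<..1} - (jump_times g \<union> T)" "t \<in> {-1..1}" for r t
  proof -
    have "jump g r = 0" "jump f (\<phi> r) = 0"
      using that time_change_in'[OF \<phi>, of r] by (auto simp: T_def jump_times_def)
    then show "xproc g r t = 0" "xproc f (\<phi> r) (\<phi> t) = 0"
      using that time_change_in'[OF \<phi>, of r] time_change_in[OF \<phi>, of t]
      by (auto intro!: xproc_no_jump g f)
  qed
  have "controlled_jumps g f \<phi> e (jump_times g \<union> T) 0"
  proof
    show "finite (jump_times g \<union> T)" using J T by simp
    fix A :: "real set" and t :: real
    assume A: "finite A" "A \<subseteq> {-1<..1} - (jump_times g \<union> T)" "t \<in> {-1..1}"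
    show "(\<Sum>r\<in>A. xproc g r t) \<le> 0" using zero(1) A by (intro sum_nonpos) (auto simp: subset_eq)
    show "(\<Sum>r\<in>A. xproc f (\<phi> r) (\<phi> t)) \<le> 0"
      using zero(2) A by (intro sum_nonpos) (auto simp: subset_eq)
  qed
  moreover have "card (jump_times g \<union> T) \<le> card (jump_times g) + card (jump_times f)"
    using card_Un_le[of "jump_times g" T] T by linarith
  ultimately show ?thesis using that by blast
qed

text \<open>The tail of \<open>g\<close> is bounded by subtracting from \<open>g t\<close> the contribution of \<open>S\<close>, which is close to
  that of \<open>f\<close>, and the latter nearly exhausts \<open>f\<close>.\<close>

lemma controlled_jumps_exhaust:
  assumes "time_changed g f \<phi> e" and S: "finite S" "S \<subseteq> {-1<..1}"
    and exh: "\<And>t. t \<in> {-1..1} \<Longrightarrow> f t - (\<Sum>r\<in>S. xproc f r t) \<le> \<eta>"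
  obtains T where "controlled_jumps g f \<phi> e T (\<eta> + (2 * real (card S) + 1) * e)" "card T = card S"
proof -
  interpret time_changed g f \<phi> e by fact
  define T where "T = {r \<in> {-1<..1}. \<phi> r \<in> S}"
  have inj: "inj_on \<phi> {-1<..1}" and im: "\<phi> ` {-1<..1} = {-1<..1}"
    using time_change_bij[OF \<phi>] by (auto simp: bij_betw_def)
  have \<phi>T: "\<phi> ` T = S"
  proof
    show "S \<subseteq> \<phi> ` T"
    proof
      fix y assume y: "y \<in> S"
      then obtain r where "r \<in> {-1<..1}" "y = \<phi> r" using im S(2) by (metis imageE subsetD)
      then show "y \<in> \<phi> ` T" using y by (auto simp: T_def)
    qed
  qed (auto simp: T_def)
  have T_sub: "T \<subseteq> {-1<..1}" by (auto simp: T_def)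
  have inj_T: "inj_on \<phi> T" using inj T_sub by (rule inj_on_subset)
  have card: "card T = card S" using card_image[OF inj_T] \<phi>T by simp
  have fin: "finite T" using finite_imageD[OF _ inj_T] \<phi>T S by simp
  have "controlled_jumps g f \<phi> e T (\<eta> + (2 * real (card S) + 1) * e)"
  proof
    show "finite T" by (rule fin)
    fix A :: "real set" and t :: real
    assume A: "finite A" "A \<subseteq> {-1<..1} - T" and t: "t \<in> {-1..1}"
    have \<phi>t: "\<phi> t \<in> {-1..1}" by (rule time_change_in[OF \<phi> t])
    have sum_T: "(\<Sum>r\<in>T. xproc f (\<phi> r) (\<phi> t)) = (\<Sum>r\<in>S. xproc f r (\<phi> t))"
      using sum.reindex[OF inj_T, of "\<lambda>r. xproc f r (\<phi> t)"] \<phi>T by simp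
    \<comment> \<open>Each index in \<open>T\<close> costs \<open>2 * e\<close>; the remaining
      \<open>e\<close> of the bound is spent on comparing \<open>g t\<close> with
      \<open>f (\<phi> t)\<close>.\<close>
    have "(\<Sum>r\<in>T. xproc f (\<phi> r) (\<phi> t) - 2 * e) \<le> (\<Sum>r\<in>T. xproc g r t)"
    proof (rule sum_mono)
      fix r assume "r \<in> T"
      then show "xproc f (\<phi> r) (\<phi> t) - 2 * e \<le> xproc g r t"
        using xproc_near[of r t] T_sub t by (auto simp: abs_le_iff)
    qed
    moreover have "(\<Sum>r\<in>A \<union> T. xproc g r t) \<le> g t"
      using A fin T_sub by (intro sum_xproc_le[OF g _ _ t]) auto
    moreover have "(\<Sum>r\<in>A \<union> T. xproc g r t) = (\<Sum>r\<in>A. xproc g r t) + (\<Sum>r\<in>T. xproc g r t)"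
      using A fin by (intro sum.union_disjoint) auto
    ultimately show "(\<Sum>r\<in>A. xproc g r t) \<le> \<eta> + (2 * real (card S) + 1) * e"
      using near[OF t] exh[OF \<phi>t] sum_T by (simp add: sum_subtractf card algebra_simps abs_le_iff)
    \<comment> \<open>The image of \<open>A\<close> is disjoint from \<open>S\<close>, so its terms
      fit into what \<open>S\<close> leaves of \<open>f (\<phi> t)\<close>.\<close>
    have "(\<Sum>r\<in>\<phi> ` A \<union> S. xproc f r (\<phi> t)) \<le> f (\<phi> t)"
      using A S time_change_in'[OF \<phi>] by (intro sum_xproc_le[OF f _ _ \<phi>t]) blast+
    moreover have "(\<Sum>r\<in>\<phi> ` A \<union> S. xproc f r (\<phi> t))
        = (\<Sum>r\<in>\<phi> ` A. xproc f r (\<phi> t)) + (\<Sum>r\<in>S. xproc f r (\<phi> t))"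
      using A S by (intro sum.union_disjoint) (auto simp: T_def)
    moreover have "inj_on \<phi> A" using inj A by (blast intro: inj_on_subset)
    then have "(\<Sum>r\<in>\<phi> ` A. xproc f r (\<phi> t)) = (\<Sum>r\<in>A. xproc f (\<phi> r) (\<phi> t))"
      by (simp add: sum.reindex)
    ultimately have "(\<Sum>r\<in>A. xproc f (\<phi> r) (\<phi> t)) \<le> \<eta>" using exh[OF \<phi>t] by linarith
    then show "(\<Sum>r\<in>A. xproc f (\<phi> r) (\<phi> t)) \<le> \<eta> + (2 * real (card S) + 1) * e"
      using e_nonneg mult_nonneg_nonneg[of "2 * real (card S) + 1" e] by linarith
  qed
  then show ?thesis using that card by blast
qed

text \<open>Finitely many jumps of \<open>f\<close> have a common lower bound
  \<open>\<kappa>\<close>, and a close enough \<open>F n\<close> must jump at the corresponding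
  times, so it has at least as many jumps.\<close>

lemma card_jump_times_limit:
  assumes f: "excursion f" and F: "\<And>n. excursion (F n)"
    and lim: "(\<lambda>n. skorokhod_dist (F n) f) \<longlonglongrightarrow> 0"
    and N: "\<And>n. finite (jump_times (F n)) \<and> card (jump_times (F n)) \<le> N"
  shows "finite (jump_times f) \<and> card (jump_times f) \<le> N"
proof (rule finite_if_finite_subsets_card_bdd)
  fix G assume G: "G \<subseteq> jump_times f" "finite G"
  have "0 < jump f r" if "r \<in> G" for r
    using G that jump_nonneg[OF f, of r] by (force simp: jump_times_def)
  then obtain \<kappa> where \<kappa>: "0 < \<kappa>" "\<And>r. r \<in> G \<Longrightarrow> \<kappa> \<le> jump f r"
    using finite_set_pos_lower_bound[OF G(2)] by blast
  \<comment> \<open>With error \<open>\<kappa> / 3\<close>, corresponding jumps differ by at most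
    \<open>2 * \<kappa> / 3\<close>, which is less than \<open>\<kappa>\<close>.\<close>
  obtain n where "skorokhod_dist (F n) f < \<kappa> / 3"
    using order_tendstoD(2)[OF lim, of "\<kappa> / 3"] \<kappa>(1) by (auto dest: eventually_happens)
  then obtain \<phi> where \<phi>: "\<phi> \<in> time_changes" "\<And>t. t \<in> {-1..1} \<Longrightarrow> \<bar>F n t - f (\<phi> t)\<bar> < \<kappa> / 3"
    using skorokhod_dist_lessD[OF F f] by metis
  interpret time_changed "F n" f \<phi> "\<kappa> / 3"
    by unfold_locales (use F f \<phi> in \<open>auto intro: less_imp_le\<close>)
  have "G \<subseteq> \<phi> ` jump_times (F n)"
  proof
    fix y assume y: "y \<in> G"
    then have "y \<in> {-1<..1}" using G by (auto simp: jump_times_def)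
    then obtain r where r: "r \<in> {-1<..1}" "y = \<phi> r"
      using time_change_bij[OF \<phi>(1)] unfolding bij_betw_def by (metis imageE)
    then have "jump (F n) r \<noteq> 0" using jump_near[OF r(1)] \<kappa>(2)[OF y] \<kappa>(1) by auto
    then show "y \<in> \<phi> ` jump_times (F n)" using r by (auto simp: jump_times_def)
  qed
  then have "card G \<le> card (jump_times (F n))" using N surj_card_le by blast
  then show "card G \<le> N" using N[of n] by simp
qed

text \<open>Here the two alternatives of the hypothesis are brought to one form. \<open>K\<close>
  and \<open>\<delta>\<close> are fixed before \<open>n\<close> and \<open>e\<close>, so that
  \<open>K * e\<close> can be made small afterwards.\<close>

lemma uniformly_controlled_jumps:
  assumes f: "excursion f" and F: "\<And>n. excursion (F n)"
    and lim: "(\<lambda>n. skorokhod_dist (F n) f) \<longlonglongrightarrow> 0"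
    and dich: "(\<exists>N\<ge>1. \<forall>n. finite (jump_times (F n)) \<and> card (jump_times (F n)) \<le> N) \<or> PJG f"
    and \<eta>: "0 < \<eta>"
  obtains K \<delta> where "0 < \<delta>"
    "\<forall>n \<phi> e. time_changed (F n) f \<phi> e \<longrightarrow> e < \<delta> \<longrightarrow>
      (\<exists>S \<eta>'. controlled_jumps (F n) f \<phi> e S \<eta>' \<and> card S \<le> K \<and> \<eta>' \<le> \<eta>)"
  using dich
proof
  assume "\<exists>N\<ge>1. \<forall>n. finite (jump_times (F n)) \<and> card (jump_times (F n)) \<le> N"
  then obtain N where N: "\<And>n. finite (jump_times (F n)) \<and> card (jump_times (F n)) \<le> N" by blast
  have Nf: "finite (jump_times f) \<and> card (jump_times f) \<le> N"
    by (rule card_jump_times_limit[OF f F lim N])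
  \<comment> \<open>The tails vanish, so any positive threshold serves; \<open>N + N\<close> counts
    the jumps of \<open>F n\<close> and those of \<open>f\<close>.\<close>
  show thesis
  proof (rule that[of 1 "N + N"], simp, intro allI impI)
    fix n \<phi> e assume "time_changed (F n) f \<phi> e"
    then obtain S where "controlled_jumps (F n) f \<phi> e S 0"
      "card S \<le> card (jump_times (F n)) + card (jump_times f)"
      using controlled_jumps_finite N Nf by metis
    then show "\<exists>S \<eta>'. controlled_jumps (F n) f \<phi> e S \<eta>' \<and> card S \<le> N + N \<and> \<eta>' \<le> \<eta>"
      using N[of n] Nf \<eta> by (meson add_mono le_trans less_imp_le)
  qed
next
  assume "PJG f"
  then obtain S where S: "finite S" "S \<subseteq> {-1<..1}"
    "\<And>t. t \<in> {-1..1} \<Longrightarrow> f t - (\<Sum>r\<in>S. xproc f r t) \<le> \<eta> / 2"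
    using PJG_uniform[of f "\<eta>/2"] \<eta> by auto
  let ?c = "2 * real (card S) + 1"
  have c: "0 < ?c" by simp
  \<comment> \<open>The set \<open>S\<close> leaves at most \<open>\<eta> / 2\<close>, and the
    threshold keeps the error \<open>?c * e\<close> below the other half.\<close>
  show thesis
  proof (rule that[of "\<eta> / (2 * ?c)" "card S"], use \<eta> c in simp, intro allI impI)
    fix n \<phi> e assume tc: "time_changed (F n) f \<phi> e" and e: "e < \<eta> / (2 * ?c)"
    obtain T where T: "controlled_jumps (F n) f \<phi> e T (\<eta> / 2 + ?c * e)" "card T = card S"
      using controlled_jumps_exhaust[OF tc S] by blast
    have "?c * e \<le> \<eta> / 2" using e c by (simp add: field_simps)
    then show "\<exists>T \<eta>'. controlled_jumps (F n) f \<phi> e T \<eta>' \<and> card T \<le> card S \<and> \<eta>' \<le> \<eta>"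
      using T by (intro exI[of _ T] exI[of _ "\<eta> / 2 + ?c * e"]) auto
  qed
qed

section \<open>Uniform convergence of the coding pseudo-distances\<close>

lemma time_change_uniform_continuity:
  fixes d :: "real \<Rightarrow> real \<Rightarrow> real"
  assumes "continuous_on ({-1..1} \<times> {-1..1}) (\<lambda>(s, t). d s t)" and "0 < \<epsilon>"
  obtains \<delta> where "0 < \<delta>"
    "\<And>\<phi> s t. \<phi> \<in> time_changes \<Longrightarrow> (\<And>u. u \<in> {-1..1} \<Longrightarrow> \<bar>\<phi> u - u\<bar> < \<delta>) \<Longrightarrow> s \<in> {-1..1} \<Longrightarrow> t \<in> {-1..1} \<Longrightarrow>
      \<bar>d (\<phi> s) (\<phi> t) - d s t\<bar> < \<epsilon>"
proof -
  have "uniformly_continuous_on ({-1..1} \<times> {-1..1}) (\<lambda>(s, t). d s t)"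
    by (rule compact_uniformly_continuous[OF assms(1)]) (intro compact_Times compact_Icc)
  then obtain \<delta> where \<delta>: "0 < \<delta>" "\<And>p q. p \<in> {-1..1} \<times> {-1..1} \<Longrightarrow> q \<in> {-1..1} \<times> {-1..1} \<Longrightarrow>
      dist q p < \<delta> \<Longrightarrow> dist (case q of (s, t) \<Rightarrow> d s t) (case p of (s, t) \<Rightarrow> d s t) < \<epsilon>"
    unfolding uniformly_continuous_on_def using assms(2) by metis
  show ?thesis
  \<comment> \<open>Each coordinate of the pair moves by less than half of
    \<open>\<delta>\<close>.\<close>
  proof (rule that[of "\<delta> / 2"])
    fix \<phi> and s t :: real
    assume \<phi>: "\<phi> \<in> time_changes" "\<And>u. u \<in> {-1..1} \<Longrightarrow> \<bar>\<phi> u - u\<bar> < \<delta> / 2"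
      and st: "s \<in> {-1..1}" "t \<in> {-1..1}"
    have "dist (\<phi> s, \<phi> t) (s, t) \<le> \<bar>\<phi> s - s\<bar> + \<bar>\<phi> t - t\<bar>"
      using sqrt_sum_squares_le_sum_abs by (simp add: dist_Pair_Pair dist_real_def)
    also have "\<dots> < \<delta>" using \<phi>(2)[OF st(1)] \<phi>(2)[OF st(2)] by linarith
    finally show "\<bar>d (\<phi> s) (\<phi> t) - d s t\<bar> < \<epsilon>"
      using \<delta>(2)[of "(s, t)" "(\<phi> s, \<phi> t)"] st time_change_in[OF \<phi>(1)] by (simp add: dist_real_def)
  qed (use \<delta> in simp)
qed

lemma coding_distances_converge:
  assumes f: "excursion f" and F: "\<And>n. excursion (F n)"
    and lim: "(\<lambda>n. skorokhod_dist (F n) f) \<longlonglongrightarrow> 0"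
    and dich: "(\<exists>N\<ge>1. \<forall>n. finite (jump_times (F n)) \<and> card (jump_times (F n)) \<le> N) \<or> PJG f"
    and \<epsilon>: "0 < \<epsilon>"
  shows "\<forall>\<^sub>F n in sequentially. \<forall>s\<in>{-1..1}. \<forall>t\<in>{-1..1}.
    \<bar>dL (F n) s t - dL f s t\<bar> \<le> \<epsilon> \<and> \<bar>dT (F n) s t - dT f s t\<bar> \<le> \<epsilon>"
proof -
  \<comment> \<open>The four tails in \<open>dL_near\<close> and \<open>dT_near\<close> then cost at
    most \<open>\<epsilon> / 4\<close> together.\<close>
  have \<eta>: "0 < \<epsilon> / 16" using \<epsilon> by simp
  obtain K :: nat and \<delta> where \<delta>: "0 < \<delta>"
    "\<forall>n \<phi> e. time_changed (F n) f \<phi> e \<longrightarrow> e < \<delta> \<longrightarrow>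
      (\<exists>S \<eta>'. controlled_jumps (F n) f \<phi> e S \<eta>' \<and> card S \<le> K \<and> \<eta>' \<le> \<epsilon> / 16)"
    by (rule uniformly_controlled_jumps[OF f F lim dich \<eta>]) (rule that)
  obtain \<alpha> where \<alpha>: "0 < \<alpha>"
    "\<And>\<phi> s t. \<phi> \<in> time_changes \<Longrightarrow> (\<And>u. u \<in> {-1..1} \<Longrightarrow> \<bar>\<phi> u - u\<bar> < \<alpha>) \<Longrightarrow> s \<in> {-1..1} \<Longrightarrow> t \<in> {-1..1} \<Longrightarrow>
      \<bar>dL f (\<phi> s) (\<phi> t) - dL f s t\<bar> < \<epsilon> / 2"
    using time_change_uniform_continuity[OF continuous_on_dL[OF f], of "\<epsilon>/2"] \<epsilon> by auto
  obtain \<beta> where \<beta>: "0 < \<beta>"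
    "\<And>\<phi> s t. \<phi> \<in> time_changes \<Longrightarrow> (\<And>u. u \<in> {-1..1} \<Longrightarrow> \<bar>\<phi> u - u\<bar> < \<beta>) \<Longrightarrow> s \<in> {-1..1} \<Longrightarrow> t \<in> {-1..1} \<Longrightarrow>
      \<bar>dT f (\<phi> s) (\<phi> t) - dT f s t\<bar> < \<epsilon> / 2"
    using time_change_uniform_continuity[OF continuous_on_dT[OF f], of "\<epsilon>/2"] \<epsilon> by auto
  \<comment> \<open>\<open>\<delta>\<close> grants the jump control, \<open>\<alpha>\<close> and
    \<open>\<beta>\<close> bound the effect of moving times by \<open>\<epsilon> / 2\<close>, and
    the factor 24 brings \<open>6 * (K + 1) * e\<close> down to
    \<open>\<epsilon> / 4\<close>.\<close>
  define e where "e = min (min (\<delta> / 2) (\<epsilon> / (24 * (real K + 1)))) (min \<alpha> \<beta>)"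
  have e: "0 < e" "e < \<delta>" "e \<le> \<alpha>" "e \<le> \<beta>" using \<delta>(1) \<alpha>(1) \<beta>(1) \<epsilon> by (auto simp: e_def)
  have "e \<le> \<epsilon> / (24 * (real K + 1))" by (simp add: e_def)
  moreover have "0 < 24 * (real K + 1)" by simp
  ultimately have "e * (24 * (real K + 1)) \<le> \<epsilon>" by (simp only: pos_le_divide_eq)
  then have eK: "6 * (real K * e) + 6 * e \<le> \<epsilon> / 4" by (simp add: algebra_simps)
  from order_tendstoD(2)[OF lim e(1)] show ?thesis
  proof eventually_elim
    case (elim n)
    obtain \<phi> where tc: "\<phi> \<in> time_changes" "\<And>t. t \<in> {-1..1} \<Longrightarrow> \<bar>\<phi> t - t\<bar> < e"
      "\<And>t. t \<in> {-1..1} \<Longrightarrow> \<bar>F n t - f (\<phi> t)\<bar> < e"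
      using skorokhod_dist_lessD[OF F f elim] by blast
    have "time_changed (F n) f \<phi> e"
      by unfold_locales (use F f tc in \<open>auto intro: less_imp_le\<close>)
    then obtain S \<eta> where ctl: "controlled_jumps (F n) f \<phi> e S \<eta>" "card S \<le> K" "\<eta> \<le> \<epsilon> / 16"
      using \<delta>(2) e(2) by blast
    interpret controlled_jumps "F n" f \<phi> e S \<eta> by (rule ctl(1))
    have "0 \<le> real (card S) * e" "real (card S) * e \<le> real K * e" using ctl(2) e(1) by simp_all
    then have cS: "real (card S) * (6 * e) + 6 * e \<le> \<epsilon> / 4"
      "real (card S) * (4 * e) + 4 * e \<le> \<epsilon> / 4"
      using eK e(1) unfolding mult.left_commute[of "real (card S)"] by linarith+
    show ?case
    proof (intro ballI conjI)
      fix s t :: real assume st: "s \<in> {-1..1}" "t \<in> {-1..1}"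
      have "\<bar>dL f (\<phi> s) (\<phi> t) - dL f s t\<bar> < \<epsilon> / 2"
        using tc(2) e(3) by (intro \<alpha>(2) tc(1) st) (meson less_le_trans)
      then show "\<bar>dL (F n) s t - dL f s t\<bar> \<le> \<epsilon>"
        using dL_near[OF st] cS(1) ctl(3) e(1) by linarith
      have "\<bar>dT f (\<phi> s) (\<phi> t) - dT f s t\<bar> < \<epsilon> / 2"
        using tc(2) e(4) by (intro \<beta>(2) tc(1) st) (meson less_le_trans)
      then show "\<bar>dT (F n) s t - dT f s t\<bar> \<le> \<epsilon>"
        using dT_near[OF st] cS(2) ctl(3) e(1) by linarith
    qed
  qed
qed

theorem theorem1p4:
  fixes f :: "real \<Rightarrow> real" and F :: "nat \<Rightarrow> real \<Rightarrow> real"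
  assumes "excursion f"
    and "\<And>n. excursion (F n)"
    and "(\<lambda>n. skorokhod_dist (F n) f) \<longlonglongrightarrow> 0"
    and "(\<exists>N\<ge>1. \<forall>n. finite (jump_times (F n)) \<and> card (jump_times (F n)) \<le> N) \<or> PJG f"
  shows "((\<lambda>n. GHP_dist (looptree (F n)) (looptree f)) \<longlonglongrightarrow> 0) \<and>
         ((\<lambda>n. GHP_dist (tree_space (F n)) (tree_space f)) \<longlonglongrightarrow> 0) \<and>
         ((\<lambda>n. GHP_dist (vernation_tree (F n)) (vernation_tree f)) \<longlonglongrightarrow> 0)"
proof -
  \<comment> \<open>The estimates were made on \<open>[-1,1]\<close>, where the time changes act;
    the coded spaces are quotients of \<open>[0,1]\<close>.\<close>
  have sub: "{0..1} \<subseteq> {-1..1::real}" "{0..1} \<times> {0..1} \<subseteq> {-1..1::real} \<times> {-1..1::real}" by auto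
  have pL: "pseudo_dist_on {0..1} (dL h)" and pT: "pseudo_dist_on {0..1} (dT h)"
    and cL: "continuous_on ({0..1} \<times> {0..1}) (\<lambda>(s, t). dL h s t)"
    and cT: "continuous_on ({0..1} \<times> {0..1}) (\<lambda>(s, t). dT h s t)" if h: "excursion h" for h
    using pseudo_dist_on_subset[OF pseudo_dist_on_dL[OF h] sub(1)]
      pseudo_dist_on_subset[OF pseudo_dist_on_dT[OF h] sub(1)]
      continuous_on_subset[OF continuous_on_dL[OF h] sub(2)]
      continuous_on_subset[OF continuous_on_dT[OF h] sub(2)] .
  have pV: "pseudo_dist_on {0..1} (dV h)" if h: "excursion h" for h
    using pseudo_dist_on_add[OF pT[OF h] pL[OF h], of 2] by (simp add: dV_def[abs_def])
  have cV: "continuous_on ({0..1} \<times> {0..1}) (\<lambda>(s, t). dV h s t)" if h: "excursion h" for h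
    using continuous_on_add[OF cT[OF h] continuous_on_mult_left[OF cL[OF h], of 2]]
    by (simp add: dV_def case_prod_beta)
  note conv = coding_distances_converge[OF assms]
  have L: "\<forall>\<^sub>F n in sequentially. \<forall>s\<in>{0..1}. \<forall>t\<in>{0..1}. \<bar>dL (F n) s t - dL f s t\<bar> \<le> e" if "0 < e" for e
    using conv[OF that] by eventually_elim (use sub in blast)
  have T: "\<forall>\<^sub>F n in sequentially. \<forall>s\<in>{0..1}. \<forall>t\<in>{0..1}. \<bar>dT (F n) s t - dT f s t\<bar> \<le> e" if "0 < e" for e
    using conv[OF that] by eventually_elim (use sub in blast)
  have V: "\<forall>\<^sub>F n in sequentially. \<forall>s\<in>{0..1}. \<forall>t\<in>{0..1}. \<bar>dV (F n) s t - dV f s t\<bar> \<le> e" if "0 < e" for e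
  proof -
    \<comment> \<open>\<open>dV\<close> is \<open>dT\<close> plus twice \<open>dL\<close>, which
      accounts for three thirds.\<close>
    have "0 < e / 3" using that by simp
    from L[OF this] T[OF this] show ?thesis
    proof eventually_elim
      case (elim n)
      show ?case
      proof (intro ballI)
        fix s t :: real assume "s \<in> {0..1}" "t \<in> {0..1}"
        then have "\<bar>dL (F n) s t - dL f s t\<bar> \<le> e / 3" "\<bar>dT (F n) s t - dT f s t\<bar> \<le> e / 3"
          using elim by blast+
        then show "\<bar>dV (F n) s t - dV f s t\<bar> \<le> e" unfolding dV_def by linarith
      qed
    qed
  qed
  show ?thesis
    unfolding looptree_def tree_space_def vernation_tree_def
    using assms by (intro conjI GHP_dist_coded_space_tendsto pL pT pV cL cT cV L T V)
qed

end
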